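(* Let $\mathcal{P} = \{ q_{\ell} \colon M_{\ell} \to M_{\ell-1} \mid \ell \geq 1\}$ and $\mathcal{P}' = \{ q'_{\ell} \colon M'_{\ell} \to M'_{\ell-1} \mid \ell \geq 1\}$ be presentations, with associated solenoidal manifolds $\mathcal{S}_{\mathcal{P}}$ and $\mathcal{S}_{\mathcal{P}'}$. If $\mathcal{S}_{\mathcal{P}}$ and $\mathcal{S}_{\mathcal{P}'}$ are homeomorphic, then $\Pi_a[\mathcal{P}] = \Pi_a[\mathcal{P}']$. That is, the asymptotic Steinitz order $\Pi_a[\mathcal{P}]$ of a presentation depends only on the homeomorphism type of the solenoidal manifold $\mathcal{S}_{\mathcal{P}}$.
   Context: A presentation is a sequence $\mathcal{P} = \{ q_{\ell} \colon M_{\ell} \to M_{\ell-1} \mid \ell \geq 1\}$ of proper finite covering maps (finite covering maps of degree $m_\ell > 1$), where each $M_\ell$ ($\ell \ge 0$) is a compact connected manifold without boundary of dimension $n \geq 1$. The associated solenoidal manifold is the inverse limit $\mathcal{S}_{\mathcal{P}} = \varprojlim \{ q_{\ell} \colon M_{\ell} \to M_{\ell-1}\} = \{(x_0,x_1,\ldots) \in \prod_{\ell \geq 0} M_\ell \mid q_\ell(x_\ell) = x_{\ell-1} \text{ for all } \ell \geq 1\}$ with the topology induced from the product topology. A Steinitz number is a formal product $\Pi = \prod_{p} p^{n(p)}$ over all primes $p$, with $0 \leq n(p) \leq \infty$. Multiplication of Steinitz numbers adds exponents. The least common multiple $LCM$ of a collection of Steinitz numbers (in particular of positive integers) is the Steinitz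 number whose exponent at each prime $p$ is the supremum of the exponents of $p$ over the collection. Two Steinitz numbers $\Pi, \Pi'$ are asymptotically equivalent if there exist integers $1 \leq m_0, n_0 < \infty$ with $n_0 \cdot \Pi = m_0 \cdot \Pi'$. The Steinitz order of a presentation $\mathcal{P}$ is $\Pi[\mathcal{P}] = LCM\{ m_1 m_2 \cdots m_\ell \mid \ell > 0\}$, where $m_\ell$ is the degree of $q_\ell$. The asymptotic Steinitz order $\Pi_a[\mathcal{P}]$ is the asymptotic equivalence class of $\Pi[\mathcal{P}]$. *)

theory Defs
  imports "HOL-Analysis.Analysis" "HOL-Computational_Algebra.Primes" "HOL-Library.Extended_Nat"
begin

section \<open>Steinitz numbers\<close>

text \<open>
  The formal product over all primes \<open>p\<close> of \<open>p\<close> to the power \<open>n p\<close> is represented by its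
  exponent function, normalised to \<open>0\<close> off the primes so that equality of exponents at the
  primes is equality of Steinitz numbers.
\<close>

typedef steinitz = "{n :: nat \<Rightarrow> enat. \<forall>p. \<not> prime p \<longrightarrow> n p = 0}"
  morphisms steinitz_exponent Abs_steinitz
  by (rule exI [of _ "\<lambda>_. 0"]) simp

setup_lifting type_definition_steinitz

instantiation steinitz :: comm_monoid_mult
begin

lift_definition one_steinitz :: steinitz is "\<lambda>_. 0" by simp

lift_definition times_steinitz :: "steinitz \<Rightarrow> steinitz \<Rightarrow> steinitz"
  is "\<lambda>m n p. m p + n p" by simp

instance
  by standard (transfer; simp add: fun_eq_iff ac_simps)+

end

text \<open>Only meaningful for positive integers; \<open>0\<close> is not a Steinitz number.\<close>

lift_definition steinitz_of_nat :: "nat \<Rightarrow> steinitz"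
  is "\<lambda>k p. if prime p then enat (multiplicity p k) else 0" by simp

lift_definition steinitz_LCM :: "steinitz set \<Rightarrow> steinitz"
  is "\<lambda>A p. SUP n\<in>A. n p" by (auto simp flip: bot_enat_def)

definition steinitz_asymp_equiv :: "steinitz \<Rightarrow> steinitz \<Rightarrow> bool" where
  "steinitz_asymp_equiv a b \<longleftrightarrow>
     (\<exists>m\<^sub>0 n\<^sub>0 :: nat. 1 \<le> m\<^sub>0 \<and> 1 \<le> n\<^sub>0 \<and> steinitz_of_nat n\<^sub>0 * a = steinitz_of_nat m\<^sub>0 * b)"

definition steinitz_asymp_class :: "steinitz \<Rightarrow> steinitz set" where
  "steinitz_asymp_class a = {b. steinitz_asymp_equiv a b}"

lemma steinitz_of_nat_1: "steinitz_of_nat 1 = 1"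
  by transfer (auto simp: fun_eq_iff zero_enat_def)

lemma steinitz_of_nat_mult:
  assumes "0 < a" "0 < b"
  shows "steinitz_of_nat (a * b) = steinitz_of_nat a * steinitz_of_nat b"
  using assms
  by transfer (auto simp: fun_eq_iff prime_elem_multiplicity_mult_distrib)

lemma equivp_steinitz_asymp_equiv: "equivp steinitz_asymp_equiv"
proof (rule equivpI)
  show "reflp steinitz_asymp_equiv"
    by (auto simp: reflp_def steinitz_asymp_equiv_def)
  show "symp steinitz_asymp_equiv"
    by (auto simp: symp_def steinitz_asymp_equiv_def) (metis)
  show "transp steinitz_asymp_equiv"
  proof (rule transpI)
    fix x y z
    assume "steinitz_asymp_equiv x y" "steinitz_asymp_equiv y z"
    then obtain a b c d :: nat
      where pos: "1 \<le> a" "1 \<le> b" "1 \<le> c" "1 \<le> d"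
        and xy: "steinitz_of_nat a * x = steinitz_of_nat b * y"
        and yz: "steinitz_of_nat c * y = steinitz_of_nat d * z"
      unfolding steinitz_asymp_equiv_def by metis
    have "steinitz_of_nat (c * a) * x = steinitz_of_nat c * (steinitz_of_nat b * y)"
      using pos by (simp add: steinitz_of_nat_mult mult.assoc xy)
    also have "\<dots> = steinitz_of_nat b * (steinitz_of_nat c * y)"
      by (simp add: ac_simps)
    also have "\<dots> = steinitz_of_nat (b * d) * z"
      using pos by (simp add: steinitz_of_nat_mult mult.assoc yz)
    finally show "steinitz_asymp_equiv x z"
      unfolding steinitz_asymp_equiv_def using pos
      by (intro exI [of _ "b * d"] exI [of _ "c * a"]) simp
  qed
qed

section \<open>Manifolds and finite coverings\<close>

definition locally_Euclidean :: "nat \<Rightarrow> 'a topology \<Rightarrow> bool" where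
  "locally_Euclidean n X \<longleftrightarrow>
     (\<forall>x\<in>topspace X. \<exists>U V. openin X U \<and> x \<in> U \<and> openin (Euclidean_space n) V \<and>
        subtopology X U homeomorphic_space subtopology (Euclidean_space n) V)"

text \<open>
  Charts onto open subsets of Euclidean space exclude boundary points. Nonemptiness is explicit
  because \<^const>\<open>connected_space\<close> holds for the empty space.
\<close>

definition closed_connected_manifold :: "nat \<Rightarrow> 'a topology \<Rightarrow> bool" where
  "closed_connected_manifold n X \<longleftrightarrow>
     topspace X \<noteq> {} \<and> Hausdorff_space X \<and> second_countable X \<and> locally_Euclidean n X \<and>
     compact_space X \<and> connected_space X"

text \<open>
  The analogue of \<^const>\<open>covering_space\<close> for abstract topologies.
\<close>

definition covering_map :: "'a topology \<Rightarrow> 'b topology \<Rightarrow> ('a \<Rightarrow> 'b) \<Rightarrow> bool" where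
  "covering_map X Y q \<longleftrightarrow>
     continuous_map X Y q \<and> q ` topspace X = topspace Y \<and>
     (\<forall>y\<in>topspace Y. \<exists>U. y \<in> U \<and> openin Y U \<and>
        (\<exists>\<V>. \<Union>\<V> = {x \<in> topspace X. q x \<in> U} \<and> (\<forall>V\<in>\<V>. openin X V) \<and> pairwise disjnt \<V> \<and>
             (\<forall>V\<in>\<V>. homeomorphic_map (subtopology X V) (subtopology Y U) q)))"

definition fibre :: "'a topology \<Rightarrow> ('a \<Rightarrow> 'b) \<Rightarrow> 'b \<Rightarrow> 'a set" where
  "fibre X q y = {x \<in> topspace X. q x = y}"

definition finite_covering_map :: "'a topology \<Rightarrow> 'b topology \<Rightarrow> ('a \<Rightarrow> 'b) \<Rightarrow> bool" where
  "finite_covering_map X Y q \<longleftrightarrow> covering_map X Y q \<and> (\<forall>y\<in>topspace Y. finite (fibre X q y))"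

text \<open>
  The common cardinality of the fibres; it is well defined over a nonempty connected base,
  see \<open>covering_degree_eq\<close> below.
\<close>

definition covering_degree :: "'a topology \<Rightarrow> 'b topology \<Rightarrow> ('a \<Rightarrow> 'b) \<Rightarrow> nat" where
  "covering_degree X Y q = (THE d. \<forall>y\<in>topspace Y. card (fibre X q y) = d)"

lemma covering_map_card_fibre_locally_constant:
  assumes "covering_map X Y q" "y \<in> topspace Y"
  shows "\<exists>U. openin Y U \<and> y \<in> U \<and> (\<forall>z\<in>U. card (fibre X q z) = card (fibre X q y))"
proof -
  obtain U \<V> where U: "y \<in> U" "openin Y U"
    and un: "\<Union>\<V> = {x \<in> topspace X. q x \<in> U}" and op: "\<And>V. V \<in> \<V> \<Longrightarrow> openin X V"
    and disj: "pairwise disjnt \<V>"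
    and hom: "\<And>V. V \<in> \<V> \<Longrightarrow> homeomorphic_map (subtopology X V) (subtopology Y U) q"
    using assms unfolding covering_map_def by meson
  have bij: "bij_betw q V U" if "V \<in> \<V>" for V
    using hom [OF that] openin_subset [OF op [OF that]] openin_subset [OF U(2)]
    by (simp add: homeomorphic_eq_everything_map bij_betw_def Int_absorb1)
  have "card (fibre X q z) = card \<V>" if "z \<in> U" for z
  proof -
    have "bij_betw (\<lambda>V. inv_into V q z) \<V> (fibre X q z)"
    proof (rule bij_betwI')
      have mem: "inv_into V q z \<in> V" "q (inv_into V q z) = z" if "V \<in> \<V>" for V
        using bij [OF that] \<open>z \<in> U\<close>
        by (auto simp: bij_betw_def inv_into_into f_inv_into_f)
      show "inv_into V q z = inv_into W q z \<longleftrightarrow> V = W" if "V \<in> \<V>" "W \<in> \<V>" for V W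
        using mem [OF that(1)] mem [OF that(2)] disj that
        by (metis disjnt_iff pairwiseD)
      show "inv_into V q z \<in> fibre X q z" if "V \<in> \<V>" for V
        using mem [OF that] op [OF that] openin_subset by (fastforce simp: fibre_def)
      show "\<exists>V\<in>\<V>. x = inv_into V q z" if x: "x \<in> fibre X q z" for x
      proof -
        have "x \<in> \<Union>\<V>" using x \<open>z \<in> U\<close> un by (auto simp: fibre_def)
        then obtain V where V: "V \<in> \<V>" "x \<in> V" by blast
        then have "x = inv_into V q z"
          using bij [OF V(1)] x by (auto simp: fibre_def bij_betw_def inv_into_f_f)
        then show ?thesis using V by blast
      qed
    qed
    then show ?thesis by (simp add: bij_betw_same_card)
  qed
  then show ?thesis using U by auto
qed

lemma covering_degree_eq:
  assumes cov: "covering_map X Y q" and con: "connected_space Y" and y: "y \<in> topspace Y"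
  shows "card (fibre X q y) = covering_degree X Y q"
proof -
  define A where "A = {z \<in> topspace Y. card (fibre X q z) = card (fibre X q y)}"
  define B where "B = {z \<in> topspace Y. card (fibre X q z) \<noteq> card (fibre X q y)}"
  have "openin Y A"
  proof (subst openin_subopen, rule ballI)
    fix z assume z: "z \<in> A"
    then have "z \<in> topspace Y" by (simp add: A_def)
    from covering_map_card_fibre_locally_constant [OF cov this]
    obtain U where U: "openin Y U" "z \<in> U" "\<forall>w\<in>U. card (fibre X q w) = card (fibre X q z)"
      by blast
    have "w \<in> A" if "w \<in> U" for w
    proof -
      have "w \<in> topspace Y" using openin_subset [OF U(1)] that by blast
      moreover have "card (fibre X q w) = card (fibre X q z)" using U(3) that by blast
      ultimately show ?thesis using z by (simp add: A_def)
    qed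
    then show "\<exists>T. openin Y T \<and> z \<in> T \<and> T \<subseteq> A"
      using U by blast
  qed
  moreover have "openin Y B"
  proof (subst openin_subopen, rule ballI)
    fix z assume z: "z \<in> B"
    then have "z \<in> topspace Y" by (simp add: B_def)
    from covering_map_card_fibre_locally_constant [OF cov this]
    obtain U where U: "openin Y U" "z \<in> U" "\<forall>w\<in>U. card (fibre X q w) = card (fibre X q z)"
      by blast
    have "w \<in> B" if "w \<in> U" for w
    proof -
      have "w \<in> topspace Y" using openin_subset [OF U(1)] that by blast
      moreover have "card (fibre X q w) = card (fibre X q z)" using U(3) that by blast
      ultimately show ?thesis using z by (simp add: B_def)
    qed
    then show "\<exists>T. openin Y T \<and> z \<in> T \<and> T \<subseteq> B"
      using U by blast
  qed
  moreover have "topspace Y \<subseteq> A \<union> B" "A \<inter> B = {}" "A \<noteq> {}"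
    using y by (auto simp: A_def B_def)
  ultimately have "B = {}"
    using connected_spaceD [OF con] by blast
  then have eq: "card (fibre X q z) = card (fibre X q y)" if "z \<in> topspace Y" for z
    using that unfolding B_def by blast
  show ?thesis
    unfolding covering_degree_def
  proof (rule the_equality [symmetric])
    show "\<forall>z\<in>topspace Y. card (fibre X q z) = card (fibre X q y)"
      using eq by blast
    show "d = card (fibre X q y)" if "\<forall>z\<in>topspace Y. card (fibre X q z) = d" for d
      using bspec [OF that y] by (rule sym)
  qed
qed

section \<open>Presentations and solenoidal manifolds\<close>

text \<open>
  A presentation consists of spaces \<open>M l\<close> for \<open>l \<ge> 0\<close> and bonding maps \<open>q l\<close> from \<open>M l\<close> to
  \<open>M (l - 1)\<close> for \<open>l \<ge> 1\<close>; the value \<open>q 0\<close> is never used. That all \<open>M l\<close> are carried by one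
  type is no restriction, since points of different \<open>M l\<close> are never compared.
\<close>

definition presentation :: "(nat \<Rightarrow> 'a topology) \<Rightarrow> (nat \<Rightarrow> 'a \<Rightarrow> 'a) \<Rightarrow> bool" where
  "presentation M q \<longleftrightarrow>
     (\<exists>n\<ge>1. \<forall>l. closed_connected_manifold n (M l)) \<and>
     (\<forall>l\<ge>1. finite_covering_map (M l) (M (l - 1)) (q l) \<and>
            covering_degree (M l) (M (l - 1)) (q l) > 1)"

definition solenoidal_manifold ::
    "(nat \<Rightarrow> 'a topology) \<Rightarrow> (nat \<Rightarrow> 'a \<Rightarrow> 'a) \<Rightarrow> (nat \<Rightarrow> 'a) topology" where
  "solenoidal_manifold M q =
     subtopology (product_topology M UNIV) {x. \<forall>l\<ge>1. q l (x l) = x (l - 1)}"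

definition steinitz_order :: "(nat \<Rightarrow> 'a topology) \<Rightarrow> (nat \<Rightarrow> 'a \<Rightarrow> 'a) \<Rightarrow> steinitz" where
  "steinitz_order M q =
     steinitz_LCM {steinitz_of_nat (\<Prod>i=1..l. covering_degree (M i) (M (i - 1)) (q i)) | l. l > 0}"

definition asymp_steinitz_order :: "(nat \<Rightarrow> 'a topology) \<Rightarrow> (nat \<Rightarrow> 'a \<Rightarrow> 'a) \<Rightarrow> steinitz set" where
  "asymp_steinitz_order M q = steinitz_asymp_class (steinitz_order M q)"

end

(*
  Let K_k(x) be the fibre of S_P over x in M_k, and let D(k) = m_1 ... m_k. Small balls in manifolds
  are evenly covered by every M_l, so both solenoids are locally products of a ball and a Cantor
  set, and a homeomorphism S_P -> S_P' carries small plaques into plaques because these are the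
  connected components of the local products. For large k the image of K_k(x) lies over a small
  ball of M'_0; let n(k,j) be the number of sheets of M'_j over that ball which it meets. It does
  not depend on x, since it is locally constant and M_k is connected. Splitting K_k0(x) into the
  fibres over M_k gives D(k) n(k,j) = D(k0) n(k0,j) for j large compared to k, and since the image
  of K_k0(x) is transversally open, n(k0,j) D'(j0) = n(k0,j0) D'(j) for a fixed j0 and all j >= j0.
  So D(k) divides N D'(j) for a constant N, and by symmetry the two Steinitz orders differ only by
  finite factors.
*)
theory Submission
  imports Defs
begin

section \<open>Lifts through coverings\<close>

text \<open>The obstacle is uniformity in the level: a neighbourhood that is evenly covered by one
  level may have to shrink at the next. Lifts through an arbitrary covering exist over a whole
  closed cube of a chart, so one cell serves all levels and a thread of lifts becomes a section into
  the solenoid. Only existence of lifts over cubes and uniqueness of lifts on connected sets are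
  used; fundamental groups do not occur. The second obstacle is that small connected sets over
  different cells have to be joined. Hence the covers are chosen such that two overlapping members
  lie in a common flow box, which replaces a Lebesgue number where no metric is given. The constant
  N is n(k0,j0) D(k0): multiplying the first identity of the overview by D'(j0) and inserting the
  second gives D(k) n(k,j) D'(j0) = N D'(j).\<close>

lemma continuous_map_neighbourhood:
  assumes "continuous_map T Y f" "openin Y U" "s \<in> topspace T" "f s \<in> U"
  shows "\<exists>N. openin T N \<and> s \<in> N \<and> (\<forall>x\<in>N. f x \<in> U)"
  using openin_continuous_map_preimage [OF assms(1,2)] assms(3,4)
  by (intro exI [of _ "{x \<in> topspace T. f x \<in> U}"]) simp

lemma covering_map_sheets:
  assumes "covering_map X Y q" "y \<in> topspace Y"
  shows "\<exists>U \<V>. y \<in> U \<and> openin Y U \<and> \<Union>\<V> = {x \<in> topspace X. q x \<in> U} \<and> pairwise disjnt \<V> \<and>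
    (\<forall>V\<in>\<V>. openin X V \<and> inj_on q V \<and> homeomorphic_map (subtopology X V) (subtopology Y U) q)"
proof -
  obtain U \<V> where U: "y \<in> U" "openin Y U" "\<Union>\<V> = {x \<in> topspace X. q x \<in> U}"
    "\<forall>V\<in>\<V>. openin X V" "pairwise disjnt \<V>"
    and hom: "\<forall>V\<in>\<V>. homeomorphic_map (subtopology X V) (subtopology Y U) q"
    using assms unfolding covering_map_def by meson
  have "inj_on q V" if "V \<in> \<V>" for V
    using bspec [OF hom that] openin_subset [of X V] bspec [OF U(4) that]
    by (simp add: homeomorphic_eq_everything_map Int_absorb1)
  then show ?thesis using U hom by (intro exI [of _ U] exI [of _ \<V>]) simp
qed

lemma covering_map_continuous: "covering_map X Y q \<Longrightarrow> continuous_map X Y q"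
  by (simp add: covering_map_def)

text \<open>Near a point the two lifts run either in one sheet, where \<open>q\<close> is injective,
  or in two disjoint sheets. So agreement and disagreement are both open conditions on the connected
  space \<open>T\<close>.\<close>

lemma covering_map_lift_unique:
  assumes cov: "covering_map X Y q" and con: "connected_space T"
    and g: "continuous_map T X g" and h: "continuous_map T X h"
    and eq: "\<And>s. s \<in> topspace T \<Longrightarrow> q (g s) = q (h s)"
    and t: "t \<in> topspace T" "g t = h t" and s: "s \<in> topspace T"
  shows "g s = h s"
proof -
  define A where "A = {s \<in> topspace T. g s = h s}"
  define B where "B = {s \<in> topspace T. g s \<noteq> h s}"
  have loc: "\<exists>N. openin T N \<and> s \<in> N \<and> (\<forall>x\<in>N. g x = h x \<longleftrightarrow> g s = h s)"
    if s: "s \<in> topspace T" for s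
  proof -
    have gX: "g s \<in> topspace X" and hX: "h s \<in> topspace X"
      using s g h by (auto simp: continuous_map_def)
    then have "q (g s) \<in> topspace Y"
      using covering_map_continuous [OF cov] by (auto simp: continuous_map_def)
    from covering_map_sheets [OF cov this]
    obtain U \<V> where U: "q (g s) \<in> U" "\<Union>\<V> = {x \<in> topspace X. q x \<in> U}"
      "\<forall>V\<in>\<V>. openin X V \<and> inj_on q V" "pairwise disjnt \<V>"
      by meson
    have "g s \<in> \<Union>\<V>" "h s \<in> \<Union>\<V>" using U(1,2) gX hX eq [OF s] by auto
    then obtain V W where V: "V \<in> \<V>" "g s \<in> V" and W: "W \<in> \<V>" "h s \<in> W"
      by blast
    have VW: "openin X V" "inj_on q V" "openin X W" using U(3) V(1) W(1) by auto
    obtain N where N: "openin T N" "s \<in> N" "\<forall>x\<in>N. g x \<in> V"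
      using continuous_map_neighbourhood [OF g VW(1) s V(2)] by blast
    obtain N' where N': "openin T N'" "s \<in> N'" "\<forall>x\<in>N'. h x \<in> W"
      using continuous_map_neighbourhood [OF h VW(3) s W(2)] by blast
    have "g x = h x \<longleftrightarrow> g s = h s" if "x \<in> N \<inter> N'" for x
    proof (cases "V = W")
      case True
      moreover have "x \<in> topspace T" using that openin_subset [OF N(1)] by auto
      ultimately show ?thesis
        using inj_onD [OF VW(2)] eq V(2) W(2) N(3) N'(3) that s by (metis IntE)
    next
      case False
      then have "disjnt V W" using U(4) V W by (simp add: pairwise_def)
      then show ?thesis
        using V(2) W(2) N(3) N'(3) that by (metis IntE disjnt_iff)
    qed
    then have "\<forall>x\<in>N \<inter> N'. g x = h x \<longleftrightarrow> g s = h s" by (rule ballI)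
    moreover have "openin T (N \<inter> N')" "s \<in> N \<inter> N'" using N N' by auto
    ultimately show ?thesis by (intro exI conjI)
  qed
  have "openin T A"
  proof (subst openin_subopen, rule ballI)
    fix s assume "s \<in> A"
    then have s: "s \<in> topspace T" "g s = h s" by (auto simp: A_def)
    then obtain N where N: "openin T N" "s \<in> N" "\<forall>x\<in>N. g x = h x" using loc [OF s(1)] s(2) by metis
    then have "N \<subseteq> A" using openin_subset [OF N(1)] by (auto simp: A_def)
    then show "\<exists>N. openin T N \<and> s \<in> N \<and> N \<subseteq> A" using N by blast
  qed
  moreover have "openin T B"
  proof (subst openin_subopen, rule ballI)
    fix s assume "s \<in> B"
    then have s: "s \<in> topspace T" "g s \<noteq> h s" by (auto simp: B_def)
    then obtain N where N: "openin T N" "s \<in> N" "\<forall>x\<in>N. g x \<noteq> h x" using loc [OF s(1)] s(2) by metis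
    then have "N \<subseteq> B" using openin_subset [OF N(1)] by (auto simp: B_def)
    then show "\<exists>N. openin T N \<and> s \<in> N \<and> N \<subseteq> B" using N by blast
  qed
  moreover have "topspace T \<subseteq> A \<union> B" "A \<inter> B = {}" "A \<noteq> {}"
    using t by (auto simp: A_def B_def)
  ultimately have "B = {}" using connected_spaceD [OF con] by blast
  then show ?thesis using s by (auto simp: B_def)
qed

text \<open>The point \<open>z\<close> is prescribed over an arbitrary \<open>t\<close>, not over a
  fixed base point; this lets the property pass to subspaces and survive gluing.\<close>

definition has_lifts :: "'t topology \<Rightarrow> 'a topology \<Rightarrow> ('a \<Rightarrow> 'b) \<Rightarrow> ('t \<Rightarrow> 'b) \<Rightarrow> bool" where
  "has_lifts T X q f \<longleftrightarrow>
     (\<forall>t\<in>topspace T. \<forall>z\<in>topspace X. q z = f t \<longrightarrow>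
        (\<exists>g. continuous_map T X g \<and> (\<forall>s\<in>topspace T. q (g s) = f s) \<and> g t = z))"

lemma has_liftsD:
  assumes "has_lifts T X q f" "t \<in> topspace T" "z \<in> topspace X" "q z = f t"
  obtains g where "continuous_map T X g" "\<And>s. s \<in> topspace T \<Longrightarrow> q (g s) = f s" "g t = z"
proof -
  have "\<exists>g. continuous_map T X g \<and> (\<forall>s\<in>topspace T. q (g s) = f s) \<and> g t = z"
    using assms by (simp add: has_lifts_def)
  then show ?thesis using that by blast
qed

lemma has_lifts_subtopology:
  assumes "has_lifts T X q f" shows "has_lifts (subtopology T A) X q f"
  unfolding has_lifts_def
proof (intro ballI impI)
  fix t z assume t: "t \<in> topspace (subtopology T A)" and z: "z \<in> topspace X" "q z = f t"
  have "t \<in> topspace T" using t by simp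
  then obtain g where g: "continuous_map T X g" "\<And>s. s \<in> topspace T \<Longrightarrow> q (g s) = f s" "g t = z"
    using has_liftsD [OF assms _ z] by metis
  then show "\<exists>g. continuous_map (subtopology T A) X g \<and>
      (\<forall>s\<in>topspace (subtopology T A). q (g s) = f s) \<and> g t = z"
    using continuous_map_from_subtopology [OF g(1)] by (intro exI [of _ g]) simp
qed

lemma has_lifts_evenly_covered:
  assumes f: "continuous_map T Y f"
    and U: "openin Y U" "\<Union>\<V> = {x \<in> topspace X. q x \<in> U}" 
    and hom: "\<And>V. V \<in> \<V> \<Longrightarrow> homeomorphic_map (subtopology X V) (subtopology Y U) q"
    and fU: "\<And>s. s \<in> topspace T \<Longrightarrow> f s \<in> U"
  shows "has_lifts T X q f"
  unfolding has_lifts_def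
proof (intro ballI impI)
  fix t z assume t: "t \<in> topspace T" and z: "z \<in> topspace X" "q z = f t"
  then have "z \<in> \<Union>\<V>" using U fU by auto
  then obtain V where V: "V \<in> \<V>" "z \<in> V" by blast
  obtain r where r: "homeomorphic_maps (subtopology X V) (subtopology Y U) q r"
    using hom [OF V(1)] homeomorphic_map_maps by blast
  have fc: "continuous_map T (subtopology Y U) f"
    using f fU by (simp add: continuous_map_in_subtopology image_subset_iff)
  have rc: "continuous_map (subtopology Y U) X r"
    using r by (simp add: homeomorphic_maps_def continuous_map_in_subtopology)
  have fY: "f s \<in> topspace Y" if "s \<in> topspace T" for s
    using f that by (auto simp: continuous_map_def)
  have "continuous_map T X (r \<circ> f)" using fc rc continuous_map_compose by blast
  moreover have "\<forall>s\<in>topspace T. q ((r \<circ> f) s) = f s"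
  proof -
    have "\<forall>y\<in>topspace (subtopology Y U). q (r y) = y"
      using r by (simp add: homeomorphic_maps_def)
    then show ?thesis using fU fY by simp
  qed
  moreover have "(r \<circ> f) t = z"
  proof -
    have "\<forall>x\<in>topspace (subtopology X V). r (q x) = x"
      using r by (simp add: homeomorphic_maps_def)
    then show ?thesis using z V by (simp flip: z(2))
  qed
  ultimately show "\<exists>g. continuous_map T X g \<and> (\<forall>s\<in>topspace T. q (g s) = f s) \<and> g t = z"
    by blast
qed

text \<open>The lift on \<open>A\<close> through \<open>z\<close> fixes a value at some
  \<open>c\<close> in the intersection, and a lift on \<open>B\<close> is started there. Uniqueness
  on the connected intersection makes the two agree, so they paste.\<close>

lemma has_lifts_Un_aux:
  assumes cov: "covering_map X Y q" 
    and un: "topspace T = A \<union> B" and cl: "closedin T A" "closedin T B"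
    and con: "connectedin T (A \<inter> B)" and ne: "A \<inter> B \<noteq> {}"
    and A: "has_lifts (subtopology T A) X q f" and B: "has_lifts (subtopology T B) X q f"
    and t: "t \<in> A" and z: "z \<in> topspace X" "q z = f t"
  shows "\<exists>g. continuous_map T X g \<and> (\<forall>s\<in>topspace T. q (g s) = f s) \<and> g t = z"
proof -
  have tsA: "topspace (subtopology T A) = A" and tsB: "topspace (subtopology T B) = B"
    using un by auto
  obtain g where g: "continuous_map (subtopology T A) X g" "\<And>s. s \<in> A \<Longrightarrow> q (g s) = f s" "g t = z"
    using has_liftsD [OF A, of t z] t z unfolding tsA by blast
  obtain c where c: "c \<in> A" "c \<in> B" using ne by blast
  have "g c \<in> topspace X" using g(1) c un by (auto simp: continuous_map_def)
  then obtain h where h: "continuous_map (subtopology T B) X h" "\<And>s. s \<in> B \<Longrightarrow> q (h s) = f s"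
    "h c = g c"
    using has_liftsD [OF B, of c "g c"] c g(2) unfolding tsB by blast
  have agree: "g s = h s" if s: "s \<in> A" "s \<in> B" for s
  proof (rule covering_map_lift_unique [where g = g and h = h and t = c and T = "subtopology T (A \<inter> B)", OF cov])
    show "connected_space (subtopology T (A \<inter> B))" using con by (simp add: connectedin_def)
    show "continuous_map (subtopology T (A \<inter> B)) X g" "continuous_map (subtopology T (A \<inter> B)) X h"
      using g(1) h(1) by (auto intro: continuous_map_from_subtopology_mono)
  qed (use g h c s un in auto)
  let ?k = "\<lambda>x. if x \<in> A then g x else h x"
  have "continuous_map T X ?k"
  proof (rule pasting_lemma_closed [where I = UNIV and T = "\<lambda>b. if b then A else B"
        and f = "\<lambda>b. if b then g else h"])
    show "continuous_map (subtopology T (if i then A else B)) X (if i then g else h)" for i :: bool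
      using g h by auto
    show "\<exists>j. j \<in> UNIV \<and> x \<in> (if j then A else B) \<and>
         (if x \<in> A then g x else h x) = (if j then g else h) x" if "x \<in> topspace T" for x
      using that un by (cases "x \<in> A") auto
  qed (use cl agree in \<open>auto split: if_splits\<close>)
  moreover have "\<forall>s\<in>topspace T. q (?k s) = f s" using g h un by auto
  ultimately show ?thesis using t g(3) by (intro exI [of _ ?k]) auto
qed

lemma has_lifts_Un:
  assumes cov: "covering_map X Y q" 
    and un: "topspace T = A \<union> B" and cl: "closedin T A" "closedin T B"
    and con: "connectedin T (A \<inter> B)" and ne: "A \<inter> B \<noteq> {}"
    and A: "has_lifts (subtopology T A) X q f" and B: "has_lifts (subtopology T B) X q f"
  shows "has_lifts T X q f"
  unfolding has_lifts_def
proof (intro ballI impI)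
  fix t z assume t: "t \<in> topspace T" and z: "z \<in> topspace X" "q z = f t"
  show "\<exists>g. continuous_map T X g \<and> (\<forall>s\<in>topspace T. q (g s) = f s) \<and> g t = z"
  proof (cases "t \<in> A")
    case True
    then show ?thesis using has_lifts_Un_aux [OF cov un cl con ne A B _ z] by blast
  next
    case False
    then have "t \<in> B" using t un by auto
    moreover have "topspace T = B \<union> A" "connectedin T (B \<inter> A)" "B \<inter> A \<noteq> {}"
      using un con ne by (auto simp: Int_commute)
    ultimately show ?thesis using has_lifts_Un_aux [OF cov _ cl(2,1) _ _ B A _ z] by blast
  qed
qed

section \<open>Boxes in \<open>nat \<Rightarrow> real\<close> and lifts over Euclidean cells\<close>

definition product_box :: "(nat \<Rightarrow> real set) \<Rightarrow> (nat \<Rightarrow> real) set" where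
  "product_box I = {x. \<forall>i. x i \<in> I i}"

lemma product_box_PiE: "product_box I = PiE UNIV I"
  by (auto simp: product_box_def PiE_UNIV_domain)

lemma connected_product_box:
  assumes "\<And>i. connected (I i)"
  shows "connected (product_box I)"
proof -
  have "connectedin (powertop_real UNIV) (PiE UNIV I)"
    using assms by (simp add: connectedin_PiE connectedin_iff_connected)
  then show ?thesis
    by (simp add: euclidean_product_topology connectedin_iff_connected product_box_PiE)
qed

lemma closed_product_box:
  assumes "\<And>i. closed (I i)"
  shows "closed (product_box I)"
proof -
  have "product_box I = (\<Inter>i. (\<lambda>x. x i) -` I i)" by (auto simp: product_box_def)
  moreover have "closed ((\<lambda>x::nat \<Rightarrow> real. x i) -` I i)" for i
    using assms by (intro closed_vimage continuous_on_product_coordinates)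
  ultimately show ?thesis by auto
qed

lemma product_box_Int: "product_box I \<inter> product_box J = product_box (\<lambda>i. I i \<inter> J i)"
  by (auto simp: product_box_def)

text \<open>A basic open set of the product restricts only finitely many coordinates, so one radius
  serves all of them, although sup-balls themselves are not open in this topology.\<close>

lemma open_coordinate_neighbourhood:
  fixes p :: "nat \<Rightarrow> real"
  assumes "open N" "p \<in> N"
  obtains e where "e > 0" "\<And>x. (\<And>i. \<bar>x i - p i\<bar> < e) \<Longrightarrow> x \<in> N"
proof -
  have "openin (product_topology (\<lambda>i. euclidean) UNIV) N"
    using assms(1) by (simp add: open_fun_def)
  from product_topology_open_contains_basis [OF this assms(2)]
  obtain X where X: "p \<in> (\<Pi>\<^sub>E i\<in>UNIV. X i)" "\<And>i. openin euclidean (X i)" 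
    "finite {i. X i \<noteq> topspace euclidean}" "(\<Pi>\<^sub>E i\<in>UNIV. X i) \<subseteq> N"
    by blast
  define F where "F = {i. X i \<noteq> UNIV}"
  have F: "finite F" using X(3) by (simp add: F_def)
  have "\<exists>e>0. \<forall>y. \<bar>y - p i\<bar> < e \<longrightarrow> y \<in> X i" for i
  proof -
    have "open (X i)" "p i \<in> X i" using X by (auto simp: PiE_UNIV_domain)
    then show ?thesis by (simp add: open_dist dist_real_def)
  qed
  then obtain e where e: "\<And>i. e i > 0" "\<And>i y. \<bar>y - p i\<bar> < e i \<Longrightarrow> y \<in> X i"
    by metis
  define d where "d = Min (insert 1 (e ` F))"
  have d: "d > 0" "\<And>i. i \<in> F \<Longrightarrow> d \<le> e i" using F e(1) by (auto simp: d_def)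
  have "x \<in> N" if "\<And>i. \<bar>x i - p i\<bar> < d" for x
  proof -
    have "x i \<in> X i" for i
    proof (cases "i \<in> F")
      case True
      then show ?thesis using that [of i] d(2) [of i] e(2) [of "x i" i] by auto
    qed (simp add: F_def)
    then show ?thesis using X(4) by (auto simp: PiE_UNIV_domain)
  qed
  then show ?thesis using that d by blast
qed

lemma has_lifts_subset:
  assumes "has_lifts (top_of_set A) X q f" "B \<subseteq> A"
  shows "has_lifts (top_of_set B) X q f"
  using has_lifts_subtopology [OF assms(1), of B] assms(2)
  by (simp add: subtopology_subtopology Int_absorb1)

text \<open>
  Coordinate by coordinate: if all lifts exist over small slabs in which the first \<open>d\<close> coordinates
  are free, then Bolzano bisection in the coordinate \<open>d\<close> frees that coordinate as well, because
  slabs meeting in a common face have connected intersection.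
\<close>

lemma covering_map_box_has_lifts:
  fixes a b :: "nat \<Rightarrow> real"
  assumes cov: "covering_map X Y q"
    and f: "continuous_map (top_of_set (product_box (\<lambda>i. {a i..b i}))) Y f"
    and ab: "\<And>i. a i \<le> b i" and n: "\<And>i. n \<le> i \<Longrightarrow> a i = b i"
  shows "has_lifts (top_of_set (product_box (\<lambda>i. {a i..b i}))) X q f"
proof -
  define Q where "Q = product_box (\<lambda>i. {a i..b i})"
  \<comment> \<open>Coordinates below \<open>d\<close> range over their full sides, the others stay
    within \<open>e\<close> of \<open>p\<close>. Raising \<open>d\<close> from 0 to \<open>n\<close>
    leads from a small set around \<open>p\<close> to all of \<open>Q\<close>.\<close>
  define slab where "slab d p e = product_box (\<lambda>i. if i < d then {a i..b i} else {a i..b i} \<inter> {p i - e..p i + e})"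
    for d :: nat and p and e :: real
  have slab_Q: "slab d p e \<subseteq> Q" for d p e
    unfolding slab_def Q_def product_box_def by (auto split: if_splits)
  have claim: "\<forall>p\<in>Q. \<exists>e>0. has_lifts (top_of_set (slab d p e)) X q f" for d
  proof (induction d)
    case 0
    show ?case
    proof
      fix p assume p: "p \<in> Q"
      then have "f p \<in> topspace Y" using f by (auto simp: continuous_map_def Q_def)
      from covering_map_sheets [OF cov this]
      obtain U \<V> where U: "f p \<in> U" "openin Y U" "\<Union>\<V> = {x \<in> topspace X. q x \<in> U}"
        "\<forall>V\<in>\<V>. homeomorphic_map (subtopology X V) (subtopology Y U) q"
        by meson
      have fQ: "continuous_map (top_of_set Q) Y f" using f by (simp add: Q_def)
      obtain N where N: "openin (top_of_set Q) N" "p \<in> N" "\<forall>x\<in>N. f x \<in> U"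
        using continuous_map_neighbourhood [OF fQ U(2), of p] U(1) p by auto
      obtain N' where N': "open N'" "N = Q \<inter> N'" using N(1) by (auto simp: openin_open)
      obtain e where e: "e > 0" "\<And>x. (\<And>i. \<bar>x i - p i\<bar> < e) \<Longrightarrow> x \<in> N'"
        using open_coordinate_neighbourhood [OF N'(1), of p] N(2) N'(2) by blast
      have sub: "slab 0 p (e / 2) \<subseteq> N"
      proof
        fix x assume x: "x \<in> slab 0 p (e / 2)"
        have "\<bar>x i - p i\<bar> < e" for i
        proof -
          have "x i \<in> {p i - e / 2..p i + e / 2}" using x by (auto simp: slab_def product_box_def)
          then have "\<bar>x i - p i\<bar> \<le> e / 2" unfolding atLeastAtMost_iff by linarith
          then show ?thesis using e(1) by linarith
        qed
        then have "x \<in> N'" by (rule e(2))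
        then show "x \<in> N" using x slab_Q N'(2) by blast
      qed
      have "has_lifts (top_of_set (slab 0 p (e / 2))) X q f"
      proof (rule has_lifts_evenly_covered [OF _ U(2,3)])
        show "continuous_map (top_of_set (slab 0 p (e / 2))) Y f"
          by (rule continuous_map_from_subtopology_mono [OF fQ slab_Q])
        show "f s \<in> U" if "s \<in> topspace (top_of_set (slab 0 p (e / 2)))" for s
          using that sub N(3) by auto
      qed (use U(4) in blast)
      then show "\<exists>e>0. has_lifts (top_of_set (slab 0 p e)) X q f"
        using e(1) by (intro exI [of _ "e / 2"]) simp
    qed
  next
    case (Suc d)
    show ?case
    proof
      fix p assume p: "p \<in> Q"
      \<comment> \<open>This is \<open>slab (Suc d) p e\<close> with coordinate \<open>d\<close>
        confined to \<open>{u..v}\<close>.\<close>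
      define piece where "piece u v e = product_box (\<lambda>i. if i < d then {a i..b i} else if i = d then {u..v}
          else {a i..b i} \<inter> {p i - e..p i + e})" for u v e :: real
      have piece_iff: "x \<in> piece u v e \<longleftrightarrow> x d \<in> {u..v} \<and> (\<forall>i<d. x i \<in> {a i..b i}) \<and>
          (\<forall>i>d. x i \<in> {a i..b i} \<inter> {p i - e..p i + e})" for u v e x
      proof
        assume "x \<in> piece u v e"
        then have x: "x i \<in> (if i < d then {a i..b i} else if i = d then {u..v}
          else {a i..b i} \<inter> {p i - e..p i + e})" for i
          unfolding piece_def product_box_def by blast
        have "x i \<in> {a i..b i}" if "i < d" for i using x [of i] that by simp
        moreover have "x i \<in> {a i..b i} \<inter> {p i - e..p i + e}" if "i > d" for i
          using x [of i] that by simp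
        moreover have "x d \<in> {u..v}" using x [of d] by simp
        ultimately show "x d \<in> {u..v} \<and> (\<forall>i<d. x i \<in> {a i..b i}) \<and>
          (\<forall>i>d. x i \<in> {a i..b i} \<inter> {p i - e..p i + e})" by blast
      next
        assume "x d \<in> {u..v} \<and> (\<forall>i<d. x i \<in> {a i..b i}) \<and>
          (\<forall>i>d. x i \<in> {a i..b i} \<inter> {p i - e..p i + e})"
        then have "x i \<in> (if i < d then {a i..b i} else if i = d then {u..v}
          else {a i..b i} \<inter> {p i - e..p i + e})" for i
          using linorder_less_linear [of i d] by auto
        then show "x \<in> piece u v e" unfolding piece_def product_box_def by blast
      qed
      have piece_mono: "piece u v e \<subseteq> piece u v e'" if "e \<le> e'" for u v e e'
      proof
        have "{p i - e..p i + e} \<subseteq> {p i - e'..p i + e'}" for i using that by auto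
        then show "x \<in> piece u v e'" if "x \<in> piece u v e" for x
          using that unfolding piece_iff by blast
      qed
      have pab: "a i \<le> p i" "p i \<le> b i" for i using p by (auto simp: Q_def product_box_def)
      have "a d \<le> b d" by (rule ab)
      \<comment> \<open>The guards confine \<open>u\<close> and \<open>v\<close> to the side of
        \<open>Q\<close>, because the bisection principle supplies arbitrary real endpoints.\<close>
      then have "a d \<le> a d \<longrightarrow> b d \<le> b d \<longrightarrow> (\<exists>e>0. has_lifts (top_of_set (piece (a d) (b d) e)) X q f)"
      proof (induction rule: Bolzano [where P = "\<lambda>u v. a d \<le> u \<longrightarrow> v \<le> b d \<longrightarrow>
            (\<exists>e>0. has_lifts (top_of_set (piece u v e)) X q f)"])
        case (trans u v w)
        show ?case
        proof (intro impI)
          assume uw: "a d \<le> u" "w \<le> b d"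
          then obtain e1 where e1: "e1 > 0" "has_lifts (top_of_set (piece u v e1)) X q f"
            using trans by auto
          obtain e2 where e2: "e2 > 0" "has_lifts (top_of_set (piece v w e2)) X q f"
            using trans uw by auto
          define e where "e = min e1 e2"
          have e: "e > 0" using e1 e2 by (simp add: e_def)
          have cl: "closed (piece u v e)" for u v unfolding piece_def by (rule closed_product_box) auto
          have un: "piece u w e = piece u v e \<union> piece v w e"
          proof (intro set_eqI iffI)
            fix x assume x: "x \<in> piece u w e"
            then show "x \<in> piece u v e \<union> piece v w e"
              unfolding Un_iff piece_iff by auto
          next
            fix x assume "x \<in> piece u v e \<union> piece v w e"
            then show "x \<in> piece u w e"
              unfolding Un_iff piece_iff using trans(3,4) by auto
          qed
          have "has_lifts (top_of_set (piece u w e)) X q f"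
          proof (rule has_lifts_Un [OF cov, where A = "piece u v e" and B = "piece v w e"])
            show "topspace (top_of_set (piece u w e)) = piece u v e \<union> piece v w e" by (simp add: un)
            show "closedin (top_of_set (piece u w e)) (piece u v e)"
              "closedin (top_of_set (piece u w e)) (piece v w e)"
              using cl un by (auto intro!: closed_subset)
            have "connected (piece u v e \<inter> piece v w e)"
              unfolding piece_def product_box_Int by (rule connected_product_box) auto
            then show "connectedin (top_of_set (piece u w e)) (piece u v e \<inter> piece v w e)"
              using un by (auto simp: connectedin_subtopology connectedin_iff_connected)
            \<comment> \<open>Moving coordinate \<open>d\<close> of \<open>p\<close> to the cut
              \<open>v\<close> gives a point of the common face.\<close>
            have "p(d := v) \<in> piece u v e \<inter> piece v w e"
              using pab trans(3,4) uw e by (auto simp: piece_def product_box_def)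
            then show "piece u v e \<inter> piece v w e \<noteq> {}" by blast
            have "subtopology (top_of_set (piece u w e)) (piece u v e) = top_of_set (piece u v e)"
              "subtopology (top_of_set (piece u w e)) (piece v w e) = top_of_set (piece v w e)"
              unfolding un by (simp_all add: subtopology_subtopology Int_absorb1)
            moreover have "e \<le> e1" "e \<le> e2" by (auto simp: e_def)
            ultimately show "has_lifts (subtopology (top_of_set (piece u w e)) (piece u v e)) X q f"
              "has_lifts (subtopology (top_of_set (piece u w e)) (piece v w e)) X q f"
              using has_lifts_subset [OF e1(2) piece_mono] has_lifts_subset [OF e2(2) piece_mono]
              by auto
          qed
          then show "\<exists>e>0. has_lifts (top_of_set (piece u w e)) X q f" using e by blast
        qed
      next
        case (local x)
        \<comment> \<open>A short piece around \<open>x\<close> fits into the slab of the induction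
          hypothesis that is centred at \<open>p\<close> with coordinate \<open>d\<close> moved to
          \<open>x\<close>; its radius bounds the width and the later coordinates alike.\<close>
        then have "p(d := x) \<in> Q" using pab by (auto simp: Q_def product_box_def)
        then obtain e where e: "e > 0" "has_lifts (top_of_set (slab d (p(d := x)) e)) X q f"
          using Suc by blast
        have "\<exists>e>0. has_lifts (top_of_set (piece u v e)) X q f"
          if uv: "u \<le> x \<and> x \<le> v \<and> v - u < e" "a d \<le> u" "v \<le> b d" for u v
        proof -
          have "piece u v e \<subseteq> slab d (p(d := x)) e"
            unfolding piece_def slab_def product_box_def using uv by (fastforce split: if_splits)
          then show ?thesis using has_lifts_subset [OF e(2)] e(1) by blast
        qed
        then show ?case using e(1) by blast
      qed
      then obtain e where e: "e > 0" "has_lifts (top_of_set (piece (a d) (b d) e)) X q f"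
        by blast
      have "piece (a d) (b d) e = slab (Suc d) p e"
        unfolding piece_def slab_def by (rule arg_cong [where f = product_box], rule ext) (auto simp: less_Suc_eq)
      then show "\<exists>e>0. has_lifts (top_of_set (slab (Suc d) p e)) X q f"
        using e by auto
    qed
  qed
  have aQ: "a \<in> Q" using ab by (auto simp: Q_def product_box_def)
  then obtain e where e: "e > 0" "has_lifts (top_of_set (slab n a e)) X q f"
    using claim by blast
  \<comment> \<open>From coordinate \<open>n\<close> on the sides are single points, so the
    restriction around \<open>a\<close> excludes nothing.\<close>
  have "(if i < n then {a i..b i} else {a i..b i} \<inter> {a i - e..a i + e}) = {a i..b i}" for i
    using n [of i] e(1) by auto
  then have "slab n a e = Q" unfolding slab_def Q_def by simp
  then show ?thesis using e(2) by (simp add: Q_def)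
qed

lemma has_lifts_homeomorphic:
  assumes hom: "homeomorphic_maps T T' \<phi> \<psi>" and lifts: "has_lifts T' X q (f \<circ> \<psi>)"
  shows "has_lifts T X q f"
  unfolding has_lifts_def
proof (intro ballI impI)
  fix t z assume t: "t \<in> topspace T" and z: "z \<in> topspace X" "q z = f t"
  have \<phi>: "continuous_map T T' \<phi>" and inv: "\<forall>s\<in>topspace T. \<psi> (\<phi> s) = s"
    using hom by (simp_all add: homeomorphic_maps_def)
  have \<phi>T: "\<phi> s \<in> topspace T'" if "s \<in> topspace T" for s
    using \<phi> that by (auto simp: continuous_map_def)
  have "q z = (f \<circ> \<psi>) (\<phi> t)" using inv t z by simp
  then obtain g where g: "continuous_map T' X g" "\<forall>s\<in>topspace T'. q (g s) = (f \<circ> \<psi>) s" "g (\<phi> t) = z"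
    using has_liftsD [OF lifts \<phi>T [OF t] z(1)] by metis
  have "continuous_map T X (g \<circ> \<phi>)" by (rule continuous_map_compose [OF \<phi> g(1)])
  moreover have "\<forall>s\<in>topspace T. q ((g \<circ> \<phi>) s) = f s" using g(2) \<phi>T inv by simp
  ultimately show "\<exists>g. continuous_map T X g \<and> (\<forall>s\<in>topspace T. q (g s) = f s) \<and> g t = z"
    using g(3) by (intro exI [of _ "g \<circ> \<phi>"]) simp
qed

text \<open>A definition cannot quantify over types, so the coverings live on the type of the domain.\<close>

definition covering_liftable :: "'a topology \<Rightarrow> bool" where
  "covering_liftable T \<longleftrightarrow>
     (\<forall>(X :: 'a topology) (Y :: 'a topology) q f.
        covering_map X Y q \<longrightarrow> continuous_map T Y f \<longrightarrow> has_lifts T X q f)"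

lemma Euclidean_space_eq: "Euclidean_space n = top_of_set {x. \<forall>i\<ge>n. x i = 0}"
  by (simp add: Euclidean_space_def euclidean_product_topology)

text \<open>\<open>W\<close> is an open cube in a chart and \<open>C\<close> the corresponding
  closed cube: bisection works on the closed one, while neighbourhoods have to be open. Lifts over
  \<open>C\<close> are later restricted to \<open>W\<close>.\<close>

lemma locally_Euclidean_cell:
  fixes Y :: "'a topology"
  assumes "locally_Euclidean n Y" "openin Y N" "y \<in> N"
  shows "\<exists>W C. openin Y W \<and> y \<in> W \<and> W \<subseteq> C \<and> C \<subseteq> N \<and> connectedin Y W \<and>
           covering_liftable (subtopology Y C)"
proof -
  let ?E = "{x :: nat \<Rightarrow> real. \<forall>i\<ge>n. x i = 0}"
  have yY: "y \<in> topspace Y" using assms(2,3) openin_subset by blast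
  then obtain U V where U: "openin Y U" "y \<in> U" and V: "openin (Euclidean_space n) V"
    and "subtopology Y U homeomorphic_space subtopology (Euclidean_space n) V"
    using assms(1) unfolding locally_Euclidean_def by meson
  then obtain \<phi> \<psi> where hom: "homeomorphic_maps (subtopology Y U) (top_of_set V) \<phi> \<psi>"
    using openin_subset [OF V]
    unfolding homeomorphic_space_def Euclidean_space_eq
    by (auto simp: subtopology_subtopology Int_absorb1)
  have VE: "V \<subseteq> ?E" using openin_subset [OF V] by (simp add: Euclidean_space_eq)
  have UY: "U \<subseteq> topspace Y" using openin_subset [OF U(1)] .
  have \<phi>: "continuous_map (subtopology Y U) (top_of_set V) \<phi>"
    and \<psi>: "continuous_map (top_of_set V) (subtopology Y U) \<psi>"
    and \<psi>\<phi>: "\<forall>s\<in>U. \<psi> (\<phi> s) = s" and \<phi>\<psi>: "\<forall>x\<in>V. \<phi> (\<psi> x) = x"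
    using hom UY by (auto simp: homeomorphic_maps_def)
  have \<psi>Y: "continuous_map (top_of_set V) Y \<psi>"
    using \<psi> continuous_map_into_fulltopology by blast
  define p where "p = \<phi> y"
  have pV: "p \<in> V" using \<phi> U(2) UY by (auto simp: p_def continuous_map_def)
  have \<psi>p: "\<psi> p = y" using \<psi>\<phi> U(2) by (simp add: p_def)
  have "openin (top_of_set V) {x \<in> topspace (top_of_set V). \<psi> x \<in> N}"
    by (rule openin_continuous_map_preimage [OF \<psi>Y assms(2)])
  moreover have "openin (top_of_set ?E) V" using V by (simp add: Euclidean_space_eq)
  ultimately have "openin (top_of_set ?E) {x \<in> V. \<psi> x \<in> N}"
    using openin_trans by fastforce
  then obtain N' where N': "open N'" "{x \<in> V. \<psi> x \<in> N} = ?E \<inter> N'" by (auto simp: openin_open)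
  have "p \<in> N'" using N'(2) pV \<psi>p assms(3) by blast
  then obtain e where e: "e > 0" "\<And>x. (\<And>i. \<bar>x i - p i\<bar> < e) \<Longrightarrow> x \<in> N'"
    using open_coordinate_neighbourhood [OF N'(1), of p] by blast
  \<comment> \<open>Half-side \<open>e / 2\<close> keeps even the closed cube strictly within
    sup-distance \<open>e\<close> of \<open>p\<close>.\<close>
  define a where "a i = (if i < n then p i - e / 2 else 0)" for i
  define b where "b i = (if i < n then p i + e / 2 else 0)" for i
  define Q where "Q = product_box (\<lambda>i. {a i..b i})"
  \<comment> \<open>From coordinate \<open>n\<close> on the factor is \<open>{0}\<close>, since
    \<open>{a i<..<b i}\<close> would be empty there.\<close>
  define R where "R = product_box (\<lambda>i. if i < n then {a i<..<b i} else {0})"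
  have p0: "p i = 0" if "i \<ge> n" for i using pV VE that by blast
  have QV: "Q \<subseteq> {x \<in> V. \<psi> x \<in> N}"
  proof
    fix x assume x: "x \<in> Q"
    then have xi: "a i \<le> x i" "x i \<le> b i" for i by (auto simp: Q_def product_box_def)
    have "\<bar>x i - p i\<bar> < e" for i
      using xi [of i] e(1) p0 [of i] by (cases "i < n") (auto simp: a_def b_def)
    then have "x \<in> N'" by (rule e(2))
    moreover have "x i = 0" if "i \<ge> n" for i
      using xi [of i] that by (simp add: a_def b_def)
    ultimately show "x \<in> {x \<in> V. \<psi> x \<in> N}" using N'(2) by auto
  qed
  have RQ: "R \<subseteq> Q"
  proof
    fix x assume x: "x \<in> R"
    have "x i \<in> {a i..b i}" for i
    proof -
      have "x i \<in> (if i < n then {a i<..<b i} else {0})" using x unfolding R_def product_box_def by blast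
      then show ?thesis by (cases "i < n") (auto simp: a_def b_def)
    qed
    then show "x \<in> Q" by (simp add: Q_def product_box_def)
  qed
  have pR: "p \<in> R" using e(1) p0 by (auto simp: R_def product_box_def a_def b_def)
  have conR: "connected R" unfolding R_def by (rule connected_product_box) simp
  have "openin (top_of_set ?E) R"
  proof -
    have "open (\<Inter>i<n. (\<lambda>x :: nat \<Rightarrow> real. x i) -` {a i<..<b i})"
      by (intro open_INT ballI open_vimage continuous_on_product_coordinates) auto
    moreover have "R = ?E \<inter> (\<Inter>i<n. (\<lambda>x. x i) -` {a i<..<b i})"
    proof (intro set_eqI iffI)
      fix x assume "x \<in> R"
      then have x: "x i \<in> (if i < n then {a i<..<b i} else {0})" for i
        unfolding R_def product_box_def by blast
      have "x i = 0" if "i \<ge> n" for i using x [of i] that by simp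
      moreover have "x i \<in> {a i<..<b i}" if "i < n" for i using x [of i] that by simp
      ultimately show "x \<in> ?E \<inter> (\<Inter>i<n. (\<lambda>x. x i) -` {a i<..<b i})" by blast
    next
      fix x assume "x \<in> ?E \<inter> (\<Inter>i<n. (\<lambda>x. x i) -` {a i<..<b i})"
      then show "x \<in> R" by (auto simp: R_def product_box_def)
    qed
    ultimately show ?thesis by (auto simp: openin_open)
  qed
  moreover have RV: "R \<subseteq> V" using RQ QV by blast
  ultimately have "openin (top_of_set V) R"
    using VE openin_subset_trans by blast
  then have "openin (subtopology Y U) {s \<in> topspace (subtopology Y U). \<phi> s \<in> R}"
    by (rule openin_continuous_map_preimage [OF \<phi>])
  moreover have "{s \<in> topspace (subtopology Y U). \<phi> s \<in> R} = \<psi> ` R"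
  proof (intro set_eqI iffI)
    fix s assume "s \<in> {s \<in> topspace (subtopology Y U). \<phi> s \<in> R}"
    then show "s \<in> \<psi> ` R" using \<psi>\<phi> by (auto intro!: image_eqI [where x = "\<phi> s"])
  next
    fix s assume "s \<in> \<psi> ` R"
    then obtain x where x: "x \<in> R" "s = \<psi> x" by blast
    then have "x \<in> V" using RV by blast
    then have "\<psi> x \<in> topspace (subtopology Y U)" "\<phi> (\<psi> x) = x"
      using \<psi> \<phi>\<psi> by (auto simp: continuous_map_def)
    then show "s \<in> {s \<in> topspace (subtopology Y U). \<phi> s \<in> R}" using x by simp
  qed
  ultimately have "openin Y (\<psi> ` R)"
    using U(1) openin_trans_full by metis
  moreover have "y \<in> \<psi> ` R" using pR \<psi>p by blast
  moreover have "\<psi> ` R \<subseteq> \<psi> ` Q" using RQ by blast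
  moreover have "\<psi> ` Q \<subseteq> N" using QV by blast
  moreover have "connectedin Y (\<psi> ` R)"
    using conR RV
    by (auto intro!: connectedin_continuous_map_image [OF \<psi>Y]
        simp: connectedin_subtopology connectedin_iff_connected)
  moreover have "covering_liftable (subtopology Y (\<psi> ` Q))"
    unfolding covering_liftable_def
  proof (intro allI impI)
    fix X Z :: "'a topology" and q f
    assume cov: "covering_map X Z q" and f: "continuous_map (subtopology Y (\<psi> ` Q)) Z f"
    have QV': "Q \<subseteq> V" using QV by blast
    have "\<psi> ` Q \<subseteq> U" using QV' \<psi> by (auto simp: continuous_map_def)
    then have "continuous_map (subtopology Y (\<psi> ` Q)) (top_of_set V) \<phi>"
      using continuous_map_from_subtopology_mono [OF \<phi>] by blast
    moreover have "\<phi> (\<psi> x) = x" if "x \<in> Q" for x using that QV' \<phi>\<psi> by blast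
    ultimately have "continuous_map (subtopology Y (\<psi> ` Q)) (top_of_set Q) \<phi>"
      by (auto simp: continuous_map_in_subtopology)
    moreover have \<psi>Q: "continuous_map (top_of_set Q) (subtopology Y (\<psi> ` Q)) \<psi>"
      using continuous_map_from_subtopology_mono [OF \<psi>Y QV'] by (auto simp: continuous_map_in_subtopology)
    ultimately have "homeomorphic_maps (subtopology Y (\<psi> ` Q)) (top_of_set Q) \<phi> \<psi>"
      unfolding homeomorphic_maps_def using \<phi>\<psi> QV' by auto
    moreover have "has_lifts (top_of_set Q) X q (f \<circ> \<psi>)"
      unfolding Q_def
    proof (rule covering_map_box_has_lifts [OF cov])
      show "continuous_map (top_of_set (product_box (\<lambda>i. {a i..b i}))) Z (f \<circ> \<psi>)"
        using continuous_map_compose [OF \<psi>Q f] by (simp add: Q_def)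
      show "a i \<le> b i" for i using e(1) by (simp add: a_def b_def)
      show "a i = b i" if "n \<le> i" for i using that by (simp add: a_def b_def)
    qed
    ultimately show "has_lifts (subtopology Y (\<psi> ` Q)) X q f" by (rule has_lifts_homeomorphic)
  qed
  ultimately show ?thesis by (intro exI conjI)
qed

section \<open>Projections of a solenoid\<close>

text \<open>
  Choose finitely many \<open>N \<subseteq> K \<subseteq> U\<close> with \<open>N\<close> open, \<open>K\<close> closed and \<open>U \<in> \<U>\<close> such that the \<open>N\<close> cover.
  Around \<open>y\<close> take the points that lie in every \<open>U\<close> with \<open>y \<in> K\<close> and avoid every \<open>K\<close> with \<open>y \<notin> K\<close>.
\<close>

lemma compact_Hausdorff_pair_refinement:
  assumes comp: "compact_space Y" and haus: "Hausdorff_space Y"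
    and op: "\<forall>U\<in>\<U>. openin Y U" and cover: "topspace Y \<subseteq> \<Union>\<U>"
  shows "\<exists>\<W>. (\<forall>W\<in>\<W>. openin Y W) \<and> topspace Y \<subseteq> \<Union>\<W> \<and>
           (\<forall>W\<in>\<W>. \<forall>W'\<in>\<W>. W \<inter> W' \<noteq> {} \<longrightarrow> (\<exists>U\<in>\<U>. W \<union> W' \<subseteq> U))"
proof -
  have reg: "regular_space Y" using comp haus by (rule compact_Hausdorff_imp_regular_space)
  define \<T> where "\<T> = {(N, K, U). openin Y N \<and> closedin Y K \<and> N \<subseteq> K \<and> K \<subseteq> U \<and> U \<in> \<U>}"
  have "topspace Y \<subseteq> \<Union>(fst ` \<T>)"
  proof
    fix y assume y: "y \<in> topspace Y"
    then obtain U where U: "U \<in> \<U>" "y \<in> U" using cover by blast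
    have "closedin Y (topspace Y - U)" using op U by blast
    then obtain N B where NB: "openin Y N" "openin Y B" "y \<in> N" "topspace Y - U \<subseteq> B" "disjnt N B"
      using reg y U unfolding regular_space_def by (metis Diff_iff)
    have "N \<subseteq> topspace Y - B" using NB(1,5) openin_subset by (fastforce simp: disjnt_iff)
    then have "(N, topspace Y - B, U) \<in> \<T>" using NB U by (auto simp: \<T>_def)
    then show "y \<in> \<Union>(fst ` \<T>)" using NB(3) by force
  qed
  moreover have "\<forall>N\<in>fst ` \<T>. openin Y N" by (auto simp: \<T>_def)
  ultimately obtain \<F>' where "finite \<F>'" "\<F>' \<subseteq> fst ` \<T>" "topspace Y \<subseteq> \<Union>\<F>'"
    using comp unfolding compact_space_alt by meson
  then obtain \<F> where \<F>: "finite \<F>" "\<F> \<subseteq> \<T>" "topspace Y \<subseteq> \<Union>(fst ` \<F>)"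
    by (metis finite_subset_image)
  define W where "W y = topspace Y \<inter> (\<Inter>(N, K, U)\<in>\<F>. if y \<in> K then U else topspace Y - K)" for y
  have WU: "W y \<subseteq> U" if "(N, K, U) \<in> \<F>" "y \<in> K" for y N K U
    using that by (fastforce simp: W_def)
  have WK: "y \<in> K" if "(N, K, U) \<in> \<F>" "t \<in> W y" "t \<in> K" for y t N K U
  proof (rule ccontr)
    assume "y \<notin> K"
    then have "t \<in> topspace Y - K" using that(1,2) by (fastforce simp: W_def)
    then show False using that(3) by blast
  qed
  have "openin Y (W y)" for y
  proof -
    have "openin Y (case X of (N, K, U) \<Rightarrow> if y \<in> K then U else topspace Y - K)" if "X \<in> \<F>" for X
      using that \<F>(2) op by (auto simp: \<T>_def split: prod.splits)
    then show ?thesis unfolding W_def using \<F>(1) by (rule_tac openin_Int_Inter) auto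
  qed
  moreover have "y \<in> W y" if "y \<in> topspace Y" for y
  proof -
    have "y \<in> (if y \<in> K then U else topspace Y - K)" if "(N, K, U) \<in> \<F>" for N K U
      using that \<F>(2) \<open>y \<in> topspace Y\<close> by (auto simp: \<T>_def)
    then show ?thesis using that unfolding W_def by blast
  qed
  moreover have "\<exists>U\<in>\<U>. W y \<union> W y' \<subseteq> U" if ne: "W y \<inter> W y' \<noteq> {}" for y y'
  proof -
    \<comment> \<open>\<open>t\<close> lies in some \<open>N\<close>, hence in its \<open>K\<close>.
      Neither \<open>W y\<close> nor \<open>W y'\<close> avoids this \<open>K\<close>, so
      \<open>y\<close> and \<open>y'\<close> belong to it and both sets are contained in its
      \<open>U\<close>.\<close>
    obtain t where t: "t \<in> W y" "t \<in> W y'" using ne by blast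
    then have "t \<in> topspace Y" by (simp add: W_def)
    then have "t \<in> \<Union>(fst ` \<F>)" using \<F>(3) by blast
    then obtain N K U where F: "(N, K, U) \<in> \<F>" "t \<in> N" by auto
    then have "t \<in> K" "U \<in> \<U>" using \<F>(2) by (auto simp: \<T>_def)
    then show ?thesis using WU [OF F(1)] WK [OF F(1)] t by blast
  qed
  ultimately show ?thesis by (intro exI [of _ "W ` topspace Y"]) blast
qed

text \<open>The composite bonding map from level \<open>k + d\<close> down to level \<open>k\<close>.\<close>

primrec bond :: "(nat \<Rightarrow> 'a \<Rightarrow> 'a) \<Rightarrow> nat \<Rightarrow> nat \<Rightarrow> 'a \<Rightarrow> 'a" where
  "bond q k 0 x = x"
| "bond q k (Suc d) x = bond q k d (q (Suc (k + d)) x)"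

lemma bond_Suc_left: "bond q k (Suc d) x = q (Suc k) (bond q (Suc k) d x)"
  by (induction d arbitrary: x) simp_all

lemma continuous_map_bond:
  assumes "\<And>l. continuous_map (M (Suc l)) (M l) (q (Suc l))"
  shows "continuous_map (M (k + d)) (M k) (bond q k d)"
proof (induction d)
  case 0
  have "bond q k 0 = id" by auto
  then show ?case by simp
next
  case (Suc d)
  have "continuous_map (M (k + Suc d)) (M (k + d)) (q (Suc (k + d)))"
    using assms [of "k + d"] by simp
  from continuous_map_compose [OF this Suc] show ?case by (simp add: o_def)
qed

lemma bond_thread:
  assumes "\<And>l. q (Suc l) (x (Suc l)) = x l"
  shows "bond q k d (x (k + d)) = x k"
  by (induction d) (simp_all add: assms)

definition total_degree :: "(nat \<Rightarrow> 'a topology) \<Rightarrow> (nat \<Rightarrow> 'a \<Rightarrow> 'a) \<Rightarrow> nat \<Rightarrow> nat" where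
  "total_degree M q l = (\<Prod>i=1..l. covering_degree (M i) (M (i - 1)) (q i))"

text \<open>
  Everything about an inverse limit \<open>S\<close> that is used later, stated for maps \<open>P l\<close> out of an
  arbitrary space \<open>S\<close>: a space homeomorphic to two solenoidal manifolds then simply carries two
  such families of projections.
\<close>

locale solenoid_projections =
  fixes S :: "'c topology" and M :: "nat \<Rightarrow> 'a topology"
    and q :: "nat \<Rightarrow> 'a \<Rightarrow> 'a" and P :: "nat \<Rightarrow> 'c \<Rightarrow> 'a"
  assumes manifolds: "\<exists>n. \<forall>l. closed_connected_manifold n (M l)"
    and coverings: "finite_covering_map (M (Suc l)) (M l) (q (Suc l))"
    and compact_S: "compact_space S"
    and continuous_P: "continuous_map S (M l) (P l)"
    and P_Suc: "u \<in> topspace S \<Longrightarrow> q (Suc l) (P (Suc l) u) = P l u"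
    and basis: "openin S G \<Longrightarrow> u \<in> G \<Longrightarrow>
      \<exists>k B. openin (M k) B \<and> P k u \<in> B \<and> {v \<in> topspace S. P k v \<in> B} \<subseteq> G"
    and separating: "u \<in> topspace S \<Longrightarrow> v \<in> topspace S \<Longrightarrow> (\<And>l. P l u = P l v) \<Longrightarrow> u = v"
    and map_into: "(\<And>l. continuous_map (T :: 'a topology) (M l) (f l)) \<Longrightarrow>
      (\<And>l t. t \<in> topspace T \<Longrightarrow> q (Suc l) (f (Suc l) t) = f l t) \<Longrightarrow>
      \<exists>F. continuous_map T S F \<and> (\<forall>l. \<forall>t\<in>topspace T. P l (F t) = f l t)"
begin

section \<open>Uniqueness and construction of maps into the solenoid\<close>

lemma covering: "covering_map (M (Suc l)) (M l) (q (Suc l))"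
  using coverings by (simp add: finite_covering_map_def)

lemma manifold: "compact_space (M l)" "Hausdorff_space (M l)" "connected_space (M l)"
    "topspace (M l) \<noteq> {}"
  using manifolds by (auto simp: closed_connected_manifold_def)

lemma P_in: "u \<in> topspace S \<Longrightarrow> P l u \<in> topspace (M l)"
  using continuous_P [of l] by (auto simp: continuous_map_def)

lemma continuous_bond: "continuous_map (M (k + d)) (M k) (bond q k d)"
  by (rule continuous_map_bond) (rule covering_map_continuous [OF covering])

lemma bond_P: "u \<in> topspace S \<Longrightarrow> bond q k d (P (k + d) u) = P k u"
  by (rule bond_thread [where x = "\<lambda>l. P l u"]) (rule P_Suc)

lemma P_eq_below:
  assumes "u \<in> topspace S" "v \<in> topspace S" "P l u = P l v" "k \<le> l"
  shows "P k u = P k v"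
  using bond_P [OF assms(1), of k "l - k"] bond_P [OF assms(2), of k "l - k"] assms(3,4) by simp

lemma separating_above:
  assumes "u \<in> topspace S" "v \<in> topspace S" "\<And>n. P (k + n) u = P (k + n) v"
  shows "u = v"
proof (rule separating [OF assms(1,2)])
  show "P l u = P l v" for l
    using P_eq_below [OF assms(1,2), of "k + l" l] assms(3) by simp
qed

text \<open>After composition with the top covering the maps agree by induction, and then they are
  two lifts through that single covering.\<close>

lemma bond_lift_unique:
  assumes con: "connected_space T"
    and g: "continuous_map T (M (k + d)) g" and h: "continuous_map T (M (k + d)) h"
    and eq: "\<And>s. s \<in> topspace T \<Longrightarrow> bond q k d (g s) = bond q k d (h s)"
    and t: "t \<in> topspace T" "g t = h t" and s: "s \<in> topspace T"
  shows "g s = h s"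
  using g h eq t s
proof (induction d arbitrary: g h s)
  case 0
  then show ?case by simp
next
  case (Suc d)
  let ?q = "q (Suc (k + d))"
  have cov: "covering_map (M (k + Suc d)) (M (k + d)) ?q" using covering [of "k + d"] by simp
  have "(?q \<circ> g) s' = (?q \<circ> h) s'" if "s' \<in> topspace T" for s'
  proof (rule Suc.IH)
    show "continuous_map T (M (k + d)) (?q \<circ> g)" "continuous_map T (M (k + d)) (?q \<circ> h)"
      using continuous_map_compose Suc.prems(1,2) covering_map_continuous [OF cov] by blast+
  qed (use Suc.prems that in auto)
  then show ?case
    using covering_map_lift_unique [OF cov con Suc.prems(1,2) _ Suc.prems(4,5,6)] by simp
qed

text \<open>\<open>P k\<close> need not be a covering map, but uniqueness holds through every finite
  tower above level \<open>k\<close>, and these levels separate points.\<close>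

lemma map_into_unique:
  assumes con: "connected_space T"
    and g: "continuous_map T S g" and h: "continuous_map T S h"
    and eq: "\<And>s. s \<in> topspace T \<Longrightarrow> P k (g s) = P k (h s)"
    and t: "t \<in> topspace T" "g t = h t" and s: "s \<in> topspace T"
  shows "g s = h s"
proof (rule separating_above [where k = k])
  have gS: "g s \<in> topspace S" and hS: "h s \<in> topspace S" if "s \<in> topspace T" for s
    using g h that by (auto simp: continuous_map_def)
  show "g s \<in> topspace S" "h s \<in> topspace S" using gS hS s by auto
  fix n
  have "(P (k + n) \<circ> g) s = (P (k + n) \<circ> h) s"
  proof (rule bond_lift_unique [OF con _ _ _ t(1) _ s])
    show "continuous_map T (M (k + n)) (P (k + n) \<circ> g)" "continuous_map T (M (k + n)) (P (k + n) \<circ> h)"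
      using continuous_map_compose g h continuous_P by blast+
    show "bond q k n ((P (k + n) \<circ> g) s) = bond q k n ((P (k + n) \<circ> h) s)" if "s \<in> topspace T" for s
      using bond_P [OF gS [OF that]] bond_P [OF hS [OF that]] eq [OF that] by simp
  qed (simp add: t)
  then show "P (k + n) (g s) = P (k + n) (h s)" by simp
qed

text \<open>Dependent choice builds the maps to the levels above \<open>k\<close> one by one;
  \<open>A\<close> carries an invariant such as passing through a given thread. \<open>T\<close>
  lives on the type of the levels because \<open>map_into\<close> is assumed only there.\<close>

lemma extend_thread:
  fixes T :: "'a topology"
  assumes c: "continuous_map T (M k) c" "A 0 c"
    and step: "\<And>n g. continuous_map T (M (k + n)) g \<Longrightarrow> A n g \<Longrightarrow>
      \<exists>h. continuous_map T (M (k + Suc n)) h \<and> A (Suc n) h \<and>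
          (\<forall>s\<in>topspace T. q (Suc (k + n)) (h s) = g s)"
  shows "\<exists>F f. continuous_map T S F \<and> f 0 = c \<and> (\<forall>n. A n (f n)) \<and>
           (\<forall>n. \<forall>s\<in>topspace T. P (k + n) (F s) = f n s)"
proof -
  have "\<exists>f. \<forall>n. (continuous_map T (M (k + n)) (f n) \<and> A n (f n) \<and> (n = 0 \<longrightarrow> f n = c)) \<and>
          (\<forall>s\<in>topspace T. q (Suc (k + n)) (f (Suc n) s) = f n s)"
  proof (rule dependent_nat_choice)
    show "\<exists>g. continuous_map T (M (k + 0)) g \<and> A 0 g \<and> (0 = (0::nat) \<longrightarrow> g = c)" using c by auto
    show "\<exists>h. (continuous_map T (M (k + Suc n)) h \<and> A (Suc n) h \<and> (Suc n = 0 \<longrightarrow> h = c)) \<and>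
        (\<forall>s\<in>topspace T. q (Suc (k + n)) (h s) = g s)"
      if "continuous_map T (M (k + n)) g \<and> A n g \<and> (n = 0 \<longrightarrow> g = c)" for g n
      using step [of n g] that by auto
  qed
  then obtain f where f: "\<And>n. continuous_map T (M (k + n)) (f n)" "\<And>n. A n (f n)" "f 0 = c"
    and fq: "\<And>n s. s \<in> topspace T \<Longrightarrow> q (Suc (k + n)) (f (Suc n) s) = f n s"
    by metis
  \<comment> \<open>\<open>f l\<close> takes values in level \<open>k + l\<close>, so exactly
    \<open>k\<close> bonding maps bring it down to level \<open>l\<close>. This treats levels below
    and above \<open>k\<close> uniformly.\<close>
  define g where "g l s = bond q l k (f l s)" for l s
  have "continuous_map T (M l) (g l)" for l
    using continuous_map_compose [OF _ continuous_bond [of l k], of T "f l"] f(1) [of l]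
    by (simp add: g_def [abs_def] o_def add.commute)
  moreover have "q (Suc l) (g (Suc l) s) = g l s" if "s \<in> topspace T" for l s
    using fq [OF that, of l] by (simp add: g_def add.commute flip: bond_Suc_left)
  ultimately obtain F where F: "continuous_map T S F" "\<forall>l. \<forall>t\<in>topspace T. P l (F t) = g l t"
    using map_into [of T g] by blast
  have "bond q (k + n) j (f (n + j) s) = f n s" if "s \<in> topspace T" for n j s
    by (induction j) (use fq [OF that] in \<open>simp_all add: add.assoc\<close>)
  from this [where j = k] have "P (k + n) (F s) = f n s" if "s \<in> topspace T" for n s
    using F(2) that unfolding g_def by (metis add.commute)
  then show ?thesis using F(1) f by (intro exI [of _ F] exI [of _ f]) simp
qed

text \<open>A thread over \<open>x\<close> is a map from a one-point space; surjectivity of the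
  coverings extends it upwards.\<close>

lemma P_surj:
  assumes "x \<in> topspace (M k)" obtains u where "u \<in> topspace S" "P k u = x"
proof -
  let ?T = "discrete_topology {x}"
  have "\<exists>F f. continuous_map ?T S F \<and> f 0 = id \<and> (\<forall>n::nat. True) \<and>
           (\<forall>n. \<forall>s\<in>topspace ?T. P (k + n) (F s) = f n s)"
  proof (rule extend_thread [where A = "\<lambda>_ _. True"])
    show "continuous_map ?T (M k) id" using assms by auto
    fix n and g :: "'a \<Rightarrow> 'a"
    assume "continuous_map ?T (M (k + n)) g"
    then have "g x \<in> topspace (M (k + n))" by (auto simp: continuous_map_def)
    moreover have "q (Suc (k + n)) ` topspace (M (Suc (k + n))) = topspace (M (k + n))"
      using covering [of "k + n"] by (simp add: covering_map_def)
    ultimately have "g x \<in> q (Suc (k + n)) ` topspace (M (k + Suc n))" by simp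
    then obtain z where "z \<in> topspace (M (k + Suc n))" "q (Suc (k + n)) z = g x" by auto
    then show "\<exists>h. continuous_map ?T (M (k + Suc n)) h \<and> True \<and>
          (\<forall>s\<in>topspace ?T. q (Suc (k + n)) (h s) = g s)"
      by (intro exI [of _ "\<lambda>_. z"]) auto
  qed simp
  then obtain F f where F: "continuous_map ?T S F" "f 0 = id" "\<forall>n. \<forall>s\<in>topspace ?T. P (k + n) (F s) = f n s"
    by blast
  have "F x \<in> topspace S" using F(1) by (auto simp: continuous_map_def)
  moreover have "P k (F x) = x" using F(2) spec [OF F(3), of 0] by simp
  ultimately show ?thesis using that by blast
qed

section \<open>Flow boxes and plaques\<close>

text \<open>
  Over a flow box \<open>B\<close> in level \<open>k\<close>, the solenoid is a disjoint union of plaques, the images of the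
  sections \<open>sec k B u\<close>; \<open>sec k B u\<close> is meaningful only for \<open>u \<in> topspace S\<close> with \<open>P k u \<in> B\<close>.
\<close>

definition flow_box :: "nat \<Rightarrow> 'a set \<Rightarrow> bool" where
  "flow_box k B \<longleftrightarrow> openin (M k) B \<and> connectedin (M k) B \<and>
     (\<forall>u\<in>topspace S. P k u \<in> B \<longrightarrow>
       (\<exists>\<sigma>. continuous_map (subtopology (M k) B) S \<sigma> \<and> (\<forall>b\<in>B. P k (\<sigma> b) = b) \<and> \<sigma> (P k u) = u))"

definition sec :: "nat \<Rightarrow> 'a set \<Rightarrow> 'c \<Rightarrow> 'a \<Rightarrow> 'c" where
  "sec k B u = (SOME \<sigma>. continuous_map (subtopology (M k) B) S \<sigma> \<and> (\<forall>b\<in>B. P k (\<sigma> b) = b) \<and> \<sigma> (P k u) = u)"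

text \<open>Maps on the cell \<open>C\<close> lift through every covering, so a section through
  \<open>u\<close> climbs from the identity through all levels over the same set. The invariant
  handed to \<open>extend_thread\<close> makes it follow the thread of \<open>u\<close>.\<close>

lemma flow_box_neighbourhood:
  assumes "openin (M k) N" "x \<in> N"
  shows "\<exists>B. flow_box k B \<and> x \<in> B \<and> B \<subseteq> N"
proof -
  obtain n where "locally_Euclidean n (M k)"
    using manifolds by (auto simp: closed_connected_manifold_def)
  from locally_Euclidean_cell [OF this assms]
  obtain W C where W: "openin (M k) W" "x \<in> W" "W \<subseteq> C" "C \<subseteq> N" "connectedin (M k) W"
    and C: "covering_liftable (subtopology (M k) C)"
    by blast
  let ?T = "subtopology (M k) C"
  have "C \<subseteq> topspace (M k)" using W(4) openin_subset [OF assms(1)] by blast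
  then have tsT: "topspace ?T = C" by auto
  have "\<exists>\<sigma>. continuous_map (subtopology (M k) W) S \<sigma> \<and> (\<forall>b\<in>W. P k (\<sigma> b) = b) \<and> \<sigma> (P k u) = u"
    if u: "u \<in> topspace S" "P k u \<in> W" for u
  proof -
    have uC: "P k u \<in> topspace ?T" using u W(3) tsT by auto
    have "\<exists>F f. continuous_map ?T S F \<and> f 0 = id \<and> (\<forall>n. f n (P k u) = P (k + n) u) \<and>
           (\<forall>n. \<forall>s\<in>topspace ?T. P (k + n) (F s) = f n s)"
    proof (rule extend_thread [where A = "\<lambda>n g. g (P k u) = P (k + n) u"])
      show "continuous_map ?T (M k) id" by (simp add: continuous_map_from_subtopology)
      fix n and g :: "'a \<Rightarrow> 'a"
      assume g: "continuous_map ?T (M (k + n)) g" "g (P k u) = P (k + n) u"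
      have cov: "covering_map (M (k + Suc n)) (M (k + n)) (q (Suc (k + n)))"
        using covering [of "k + n"] by simp
      have "has_lifts ?T (M (k + Suc n)) (q (Suc (k + n))) g"
        using C cov g(1) unfolding covering_liftable_def by blast
      moreover have "q (Suc (k + n)) (P (k + Suc n) u) = g (P k u)"
        using P_Suc [OF u(1), of "k + n"] g(2) by simp
      ultimately show "\<exists>h. continuous_map ?T (M (k + Suc n)) h \<and> h (P k u) = P (k + Suc n) u \<and>
          (\<forall>s\<in>topspace ?T. q (Suc (k + n)) (h s) = g s)"
        using has_liftsD [OF _ uC P_in [OF u(1)]] by metis
    qed simp
    then obtain F f where F: "continuous_map ?T S F" "f 0 = id" "\<forall>n. f n (P k u) = P (k + n) u"
      "\<forall>n. \<forall>s\<in>topspace ?T. P (k + n) (F s) = f n s"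
      by blast
    have "P k (F b) = b" if "b \<in> W" for b
      using bspec [OF spec [OF F(4), of 0], of b] F(2) that W(3) tsT by auto
    moreover have "continuous_map (subtopology (M k) W) S F"
      using continuous_map_from_subtopology_mono [OF F(1) W(3)] .
    moreover have "F (P k u) = u"
    proof (rule separating_above [where k = k])
      show "F (P k u) \<in> topspace S" using F(1) uC by (auto simp: continuous_map_def)
      show "P (k + n) (F (P k u)) = P (k + n) u" for n using F(3,4) uC by simp
    qed (rule u)
    ultimately show ?thesis by blast
  qed
  then have "flow_box k W" using W by (simp add: flow_box_def)
  then show ?thesis using W by blast
qed

lemma flow_box_openin: "flow_box k B \<Longrightarrow> openin (M k) B"
  and flow_box_connectedin: "flow_box k B \<Longrightarrow> connectedin (M k) B"
  by (simp_all add: flow_box_def)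

lemma flow_box_subset: "flow_box k B \<Longrightarrow> B \<subseteq> topspace (M k)"
  using flow_box_openin openin_subset by blast

context
  fixes k B u
  assumes B: "flow_box k B" and u: "u \<in> topspace S" "P k u \<in> B"
begin

lemma sec: "continuous_map (subtopology (M k) B) S (sec k B u) \<and>
    (\<forall>b\<in>B. P k (sec k B u b) = b) \<and> sec k B u (P k u) = u"
  using B u unfolding sec_def flow_box_def by (intro someI_ex [where P = "\<lambda>\<sigma>.
    continuous_map (subtopology (M k) B) S \<sigma> \<and> (\<forall>b\<in>B. P k (\<sigma> b) = b) \<and> \<sigma> (P k u) = u"]) blast

lemma sec_continuous: "continuous_map (subtopology (M k) B) S (sec k B u)"
  and P_sec: "b \<in> B \<Longrightarrow> P k (sec k B u b) = b"
  and sec_P: "sec k B u (P k u) = u"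
  using sec by blast+

lemma sec_in: "b \<in> B \<Longrightarrow> sec k B u b \<in> topspace S"
  using sec_continuous flow_box_subset [OF B] by (auto simp: continuous_map_def)

lemma plaque_connectedin: "connectedin S (sec k B u ` B)"
  using flow_box_connectedin [OF B]
  by (intro connectedin_continuous_map_image [OF sec_continuous]) (simp add: connectedin_subtopology)

lemma plaque_mem: "u \<in> sec k B u ` B"
  using sec_P u(2) by force

text \<open>Both the identity and \<open>sec k B u \<circ> P k\<close> lift \<open>P k\<close> on \<open>C\<close>, and they agree at \<open>u\<close>.\<close>

lemma sec_of_connectedin:
  assumes C: "connectedin S C" "\<And>v. v \<in> C \<Longrightarrow> P k v \<in> B" "u \<in> C" "v \<in> C"
  shows "sec k B u (P k v) = v"
proof -
  have CS: "C \<subseteq> topspace S" using C(1) by (simp add: connectedin_def)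
  then have ts: "topspace (subtopology S C) = C" by auto
  have "(sec k B u \<circ> P k) v = id v"
  proof (rule map_into_unique [where k = k and t = u and T = "subtopology S C" and h = id])
    show "connected_space (subtopology S C)" using C(1) by (simp add: connectedin_def)
    have "continuous_map (subtopology S C) (subtopology (M k) B) (P k)"
      using C(2) ts continuous_P [of k]
      by (auto simp: continuous_map_in_subtopology continuous_map_from_subtopology)
    then show "continuous_map (subtopology S C) S (sec k B u \<circ> P k)"
      using sec_continuous continuous_map_compose by blast
    show "continuous_map (subtopology S C) S id" by (simp add: continuous_map_from_subtopology)
  qed (use C ts P_sec sec_P in auto)
  then show ?thesis by simp
qed

end

text \<open>The plaque over \<open>B'\<close> is a connected set through \<open>u\<close> lying over
  \<open>B\<close>, so the section over \<open>B\<close> recovers its points.\<close>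

lemma sec_subset:
  assumes B: "flow_box k B" and B': "flow_box k B'" "B' \<subseteq> B" and u: "u \<in> topspace S" "P k u \<in> B'" and b: "b \<in> B'"
  shows "sec k B u b = sec k B' u b"
proof -
  have uB: "P k u \<in> B" using u B' by blast
  have "sec k B u (P k (sec k B' u b)) = sec k B' u b"
  proof (rule sec_of_connectedin [OF B u(1) uB])
    show "connectedin S (sec k B' u ` B')" by (rule plaque_connectedin [OF B'(1) u])
    show "u \<in> sec k B' u ` B'" by (rule plaque_mem [OF B'(1) u])
  qed (use b P_sec [OF B'(1) u] B'(2) in auto)
  then show ?thesis using P_sec [OF B'(1) u b] by simp
qed

text \<open>A plaque is connected and lies over \<open>B\<close>, hence it is the plaque of each of
  its points.\<close>

lemma sec_sec:
  assumes B: "flow_box k B" and u: "u \<in> topspace S" "P k u \<in> B" and b: "b \<in> B" "b' \<in> B"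
  shows "sec k B (sec k B u b) b' = sec k B u b'"
proof -
  let ?v = "sec k B u b"
  have v: "?v \<in> topspace S" "P k ?v \<in> B" using sec_in [OF B u b(1)] P_sec [OF B u b(1)] b by auto
  have "sec k B ?v (P k (sec k B u b')) = sec k B u b'"
    by (rule sec_of_connectedin [OF B v plaque_connectedin [OF B u]])
      (use b P_sec [OF B u] in auto)
  then show ?thesis using P_sec [OF B u b(2)] by simp
qed

text \<open>Seen at level \<open>k + d\<close>, both plaques are lifts of the inclusion of
  \<open>B\<close> through a finite tower, so one common point forces them into the same
  sheet.\<close>

lemma sec_level:
  assumes B: "flow_box k B" and u: "u \<in> topspace S" "P k u \<in> B" and v: "v \<in> topspace S" "P k v \<in> B"
    and c: "c \<in> B" "P (k + d) (sec k B u c) = P (k + d) (sec k B v c)" and b: "b \<in> B"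
  shows "P (k + d) (sec k B u b) = P (k + d) (sec k B v b)"
proof -
  have ts: "topspace (subtopology (M k) B) = B" using flow_box_subset [OF B] by auto
  have "(P (k + d) \<circ> sec k B u) b = (P (k + d) \<circ> sec k B v) b"
  proof (rule bond_lift_unique [where t = c and T = "subtopology (M k) B" and k = k and d = d
        and g = "P (k + d) \<circ> sec k B u" and h = "P (k + d) \<circ> sec k B v"])
    show "connected_space (subtopology (M k) B)"
      using flow_box_connectedin [OF B] by (simp add: connectedin_def)
    show "continuous_map (subtopology (M k) B) (M (k + d)) (P (k + d) \<circ> sec k B u)"
      "continuous_map (subtopology (M k) B) (M (k + d)) (P (k + d) \<circ> sec k B v)"
      using sec_continuous [OF B u] sec_continuous [OF B v]
      by (simp_all add: continuous_map_compose [OF _ continuous_P])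
    show "bond q k d ((P (k + d) \<circ> sec k B u) s) = bond q k d ((P (k + d) \<circ> sec k B v) s)"
      if "s \<in> topspace (subtopology (M k) B)" for s
      using that sec_in [OF B u] sec_in [OF B v] P_sec [OF B u] P_sec [OF B v]
      unfolding ts by (simp add: bond_P)
  qed (use b c ts in auto)
  then show ?thesis by simp
qed

text \<open>Follow \<open>bond q 0 k\<close> by the section over \<open>V\<close> through a point
  above \<open>z\<close>, and then by \<open>P k\<close>. This lifts \<open>bond q 0 k\<close> on
  \<open>D\<close> and agrees with the identity at \<open>z\<close>, hence everywhere, so
  \<open>z'\<close> is recovered from its image.\<close>

lemma bond_inj_on_connectedin:
  assumes V: "flow_box 0 V" and D: "connectedin (M k) D" "\<And>z. z \<in> D \<Longrightarrow> bond q 0 k z \<in> V"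
    and z: "z \<in> D" "z' \<in> D" "bond q 0 k z = bond q 0 k z'"
  shows "z = z'"
proof -
  have "D \<subseteq> topspace (M k)" using D(1) by (simp add: connectedin_def)
  then have ts: "topspace (subtopology (M k) D) = D" and "z \<in> topspace (M k)" using z by auto
  then obtain u where u: "u \<in> topspace S" "P k u = z" using P_surj by blast
  have bu: "bond q 0 k z = P 0 u" using bond_P [OF u(1), of 0 k] u(2) by simp
  then have uV: "P 0 u \<in> V" using D(2) [OF z(1)] by simp
  let ?g = "P k \<circ> (sec 0 V u \<circ> bond q 0 k)"
  have "?g z' = id z'"
  proof (rule bond_lift_unique [where k = 0 and d = k and t = z and T = "subtopology (M k) D" and g = ?g and h = id])
    show "connected_space (subtopology (M k) D)" using D(1) by (simp add: connectedin_def)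
    have "continuous_map (subtopology (M k) D) (subtopology (M 0) V) (bond q 0 k)"
      using continuous_bond [of 0 k] D(2) ts
      by (auto simp: continuous_map_in_subtopology continuous_map_from_subtopology)
    then have "continuous_map (subtopology (M k) D) (M k) ?g"
      by (rule continuous_map_compose [OF continuous_map_compose [OF _ sec_continuous [OF V u(1) uV]] continuous_P])
    then show "continuous_map (subtopology (M k) D) (M (0 + k)) ?g" by simp
    show "continuous_map (subtopology (M k) D) (M (0 + k)) id"
      by (simp add: continuous_map_from_subtopology)
    show "bond q 0 k (?g s) = bond q 0 k (id s)" if "s \<in> topspace (subtopology (M k) D)" for s
    proof -
      have s: "bond q 0 k s \<in> V" using that D(2) ts by blast
      then show ?thesis
        using bond_P [OF sec_in [OF V u(1) uV s], of 0 k] P_sec [OF V u(1) uV s] by simp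
    qed
    show "?g z = id z" using bu sec_P [OF V u(1) uV] u(2) by simp
  qed (use z ts in auto)
  moreover have "?g z' = z" using bu z(3) sec_P [OF V u(1) uV] u(2) by simp
  ultimately show ?thesis by simp
qed

text \<open>Each basic open set depends on a single level. Finitely many of them cover
  \<open>S\<close>, and from the largest level involved onwards every fibre that meets one of them
  lies inside it.\<close>

lemma fibres_small:
  assumes op: "\<forall>G\<in>\<G>. openin S G" and cover: "topspace S \<subseteq> \<Union>\<G>"
  shows "\<exists>k\<^sub>0. \<forall>k\<ge>k\<^sub>0. \<forall>x\<in>topspace (M k). \<exists>G\<in>\<G>. {v \<in> topspace S. P k v = x} \<subseteq> G"
proof -
  define \<C> where "\<C> = {C. \<exists>k B. openin (M k) B \<and> C = {v \<in> topspace S. P k v \<in> B} \<and> (\<exists>G\<in>\<G>. C \<subseteq> G)}"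
  have "\<forall>C\<in>\<C>. openin S C"
    unfolding \<C>_def using openin_continuous_map_preimage [OF continuous_P] by auto
  moreover have "topspace S \<subseteq> \<Union>\<C>"
  proof
    fix u assume u: "u \<in> topspace S"
    then obtain G where G: "G \<in> \<G>" "u \<in> G" using cover by blast
    then obtain k B where "openin (M k) B" "P k u \<in> B" "{v \<in> topspace S. P k v \<in> B} \<subseteq> G"
      using basis op by meson
    then have "{v \<in> topspace S. P k v \<in> B} \<in> \<C>" "u \<in> {v \<in> topspace S. P k v \<in> B}"
      using u G(1) unfolding \<C>_def by auto
    then show "u \<in> \<Union>\<C>" by blast
  qed
  ultimately obtain \<F> where \<F>: "finite \<F>" "\<F> \<subseteq> \<C>" "topspace S \<subseteq> \<Union>\<F>"
    using compact_S unfolding compact_space_alt by meson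
  have "\<forall>C\<in>\<F>. \<exists>k B. C = {v \<in> topspace S. P k v \<in> B} \<and> (\<exists>G\<in>\<G>. C \<subseteq> G)"
  proof
    fix C assume "C \<in> \<F>"
    then have "C \<in> \<C>" using \<F>(2) by blast
    then show "\<exists>k B. C = {v \<in> topspace S. P k v \<in> B} \<and> (\<exists>G\<in>\<G>. C \<subseteq> G)"
      unfolding \<C>_def mem_Collect_eq by (elim exE conjE) (intro exI conjI, assumption+)
  qed
  then obtain K B where KB: "\<And>C. C \<in> \<F> \<Longrightarrow> C = {v \<in> topspace S. P (K C) v \<in> B C} \<and> (\<exists>G\<in>\<G>. C \<subseteq> G)"
    by metis
  define k\<^sub>0 where "k\<^sub>0 = Max (insert 0 (K ` \<F>))"
  have k0: "K C \<le> k\<^sub>0" if "C \<in> \<F>" for C using that \<F>(1) by (simp add: k\<^sub>0_def)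
  have "\<exists>G\<in>\<G>. {v \<in> topspace S. P k v = x} \<subseteq> G" if k: "k \<ge> k\<^sub>0" and x: "x \<in> topspace (M k)" for k x
  proof -
    obtain u where u: "u \<in> topspace S" "P k u = x" using P_surj [OF x] by blast
    then obtain C where C: "C \<in> \<F>" "u \<in> C" using \<F>(3) by blast
    obtain G where G: "G \<in> \<G>" "C \<subseteq> G" using KB [OF C(1)] by blast
    have uB: "P (K C) u \<in> B C" using KB [OF C(1)] C(2) by blast
    have "v \<in> C" if v: "v \<in> topspace S" "P k v = x" for v
    proof -
      have "P (K C) v = P (K C) u"
        using P_eq_below [OF v(1) u(1), of k "K C"] v(2) u(2) k0 [OF C(1)] k by simp
      then show ?thesis using KB [OF C(1)] v(1) uB by auto
    qed
    then show ?thesis using G by blast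
  qed
  then show ?thesis by blast
qed

text \<open>A continuous map from a compact space to a Hausdorff space is closed, so the image of
  the complement of \<open>G\<close> can be removed from \<open>M k\<close>.\<close>

lemma tube:
  assumes G: "openin S G" and x: "x \<in> topspace (M k)" "{v \<in> topspace S. P k v = x} \<subseteq> G"
  shows "\<exists>B. openin (M k) B \<and> x \<in> B \<and> {v \<in> topspace S. P k v \<in> B} \<subseteq> G"
proof -
  have "closed_map S (M k) (P k)"
    by (rule continuous_imp_closed_map [OF continuous_P compact_S manifold(2)])
  moreover have "closedin S (topspace S - G)" using G by blast
  ultimately have "closedin (M k) (P k ` (topspace S - G))" by (simp add: closed_map_def)
  then have "openin (M k) (topspace (M k) - P k ` (topspace S - G))" by blast
  moreover have "x \<in> topspace (M k) - P k ` (topspace S - G)" using x by auto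
  moreover have "{v \<in> topspace S. P k v \<in> topspace (M k) - P k ` (topspace S - G)} \<subseteq> G" by auto
  ultimately show ?thesis by (intro exI conjI)
qed

text \<open>Degrees multiply along the tower; the factor \<open>total_degree M q k\<close> allows
  stating this without a separate notion of degree between two levels.\<close>

lemma bond_fibre_card:
  assumes "x \<in> topspace (M k)"
  shows "finite {z \<in> topspace (M (k + d)). bond q k d z = x} \<and>
    card {z \<in> topspace (M (k + d)). bond q k d z = x} * total_degree M q k = total_degree M q (k + d)"
proof (induction d)
  case 0
  have "{z \<in> topspace (M k). z = x} = {x}" using assms by auto
  then show ?case by simp
next
  case (Suc d)
  define A where "A = {z \<in> topspace (M (k + d)). bond q k d z = x}"
  let ?q = "q (Suc (k + d))"
  define fib where "fib = fibre (M (Suc (k + d))) ?q"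
  have qc: "continuous_map (M (Suc (k + d))) (M (k + d)) ?q"
    by (rule covering_map_continuous [OF covering])
  have eq: "{z \<in> topspace (M (k + Suc d)). bond q k (Suc d) z = x} = (\<Union>z\<in>A. fib z)"
    using qc by (auto simp: A_def fib_def fibre_def continuous_map_def)
  have fin: "finite (fib z)" if "z \<in> A" for z
    using that coverings [of "k + d"] by (auto simp: A_def fib_def finite_covering_map_def)
  have card: "card (fib z) = covering_degree (M (Suc (k + d))) (M (k + d)) ?q" if "z \<in> A" for z
    unfolding fib_def using covering_degree_eq [OF covering manifold(3)] that by (simp add: A_def)
  have finA: "finite A" using Suc by (simp add: A_def)
  have "card (\<Union>z\<in>A. fib z) = (\<Sum>z\<in>A. card (fib z))"
    using finA fin by (intro card_UN_disjoint) (auto simp: fib_def fibre_def)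
  also have "\<dots> = card A * covering_degree (M (Suc (k + d))) (M (k + d)) ?q"
    using card by simp
  finally have "card (\<Union>z\<in>A. fib z) = card A * covering_degree (M (Suc (k + d))) (M (k + d)) ?q" .
  then show ?case
    unfolding eq using finA fin Suc 
    by (simp add: A_def [symmetric] total_degree_def mult.assoc mult.commute mult.left_commute)
qed

lemma total_degree_pos: "total_degree M q l > 0"
proof -
  obtain x where x: "x \<in> topspace (M l)" using manifold(4) [of l] by blast
  have "bond q 0 l x \<in> topspace (M 0)"
    using continuous_bond [of 0 l] x by (auto simp: continuous_map_def)
  from bond_fibre_card [OF this, of l]
  have "card {z \<in> topspace (M l). bond q 0 l z = bond q 0 l x} = total_degree M q l"
    "finite {z \<in> topspace (M l). bond q 0 l z = bond q 0 l x}"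
    by (simp_all add: total_degree_def)
  then show ?thesis using x by (metis (mono_tags, lifting) card_gt_0_iff empty_iff mem_Collect_eq)
qed

text \<open>Choose \<open>k\<close> such that the fibres of \<open>P k\<close> fit into members of
  \<open>\<G>\<close>. Only finitely many points of \<open>M k\<close> lie over \<open>y\<close>,
  and plaques in the same sheet look alike at level \<open>k\<close>, so shrinking \<open>U\<close>
  for one representative per sheet handles all plaques.\<close>

lemma small_plaques:
  assumes op: "\<forall>G\<in>\<G>. openin S G" and cover: "topspace S \<subseteq> \<Union>\<G>"
    and N: "openin (M 0) N" "y \<in> N"
  shows "\<exists>W. flow_box 0 W \<and> y \<in> W \<and> W \<subseteq> N \<and>
    (\<forall>u\<in>topspace S. P 0 u \<in> W \<longrightarrow> (\<exists>G\<in>\<G>. sec 0 W u ` W \<subseteq> G))"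
proof -
  have y: "y \<in> topspace (M 0)" using N openin_subset by blast
  obtain k where k: "\<forall>x\<in>topspace (M k). \<exists>G\<in>\<G>. {v \<in> topspace S. P k v = x} \<subseteq> G"
    using fibres_small [OF op cover] by blast
  obtain U where U: "flow_box 0 U" "y \<in> U" "U \<subseteq> N" using flow_box_neighbourhood [OF N] by blast
  define Z where "Z = {z \<in> topspace (M k). bond q 0 k z = y}"
  have finZ: "finite Z" using bond_fibre_card [OF y, of k] by (simp add: Z_def)
  have "\<exists>B. openin (M k) B \<and> z \<in> B \<and> (\<exists>G\<in>\<G>. {v \<in> topspace S. P k v \<in> B} \<subseteq> G)" if "z \<in> Z" for z
  proof -
    have z: "z \<in> topspace (M k)" using that by (simp add: Z_def)
    then obtain G where G: "G \<in> \<G>" "{v \<in> topspace S. P k v = z} \<subseteq> G" using k by blast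
    then show ?thesis using tube [OF _ z G(2)] op by blast
  qed
  then obtain B where B: "\<And>z. z \<in> Z \<Longrightarrow> openin (M k) (B z) \<and> z \<in> B z \<and>
      (\<exists>G\<in>\<G>. {v \<in> topspace S. P k v \<in> B z} \<subseteq> G)"
    by metis
  have "\<exists>u\<in>topspace S. P k u = z" if "z \<in> Z" for z
    using P_surj [of z k] that by (auto simp: Z_def)
  then obtain w where w: "\<And>z. z \<in> Z \<Longrightarrow> w z \<in> topspace S \<and> P k (w z) = z" by metis
  have w0: "P 0 (w z) = y" if "z \<in> Z" for z
    using bond_P [of "w z" 0 k] w [OF that] that by (simp add: Z_def)
  define A where "A z = {b \<in> topspace (subtopology (M 0) U). (P k \<circ> sec 0 U (w z)) b \<in> B z}" for z
  have tsU: "topspace (subtopology (M 0) U) = U" using flow_box_subset [OF U(1)] by auto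
  have A: "openin (M 0) (A z)" "y \<in> A z" if "z \<in> Z" for z
  proof -
    have wU: "w z \<in> topspace S" "P 0 (w z) \<in> U" using w w0 U(2) that by auto
    have "continuous_map (subtopology (M 0) U) (M k) (P k \<circ> sec 0 U (w z))"
      using sec_continuous [OF U(1) wU] continuous_P continuous_map_compose by blast
    from openin_continuous_map_preimage [OF this] have "openin (subtopology (M 0) U) (A z)"
      using B [OF that] unfolding A_def by blast
    then show "openin (M 0) (A z)" using flow_box_openin [OF U(1)] openin_trans_full by blast
    have "sec 0 U (w z) y = w z" using sec_P [OF U(1) wU] w0 [OF that] by simp
    then show "y \<in> A z" using w [OF that] B [OF that] U(2) tsU by (simp add: A_def)
  qed
  have "openin (M 0) (U \<inter> (\<Inter>z\<in>Z. A z))"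
    using A finZ flow_box_openin [OF U(1)] by (intro openin_Int_Inter) auto
  moreover have "y \<in> U \<inter> (\<Inter>z\<in>Z. A z)" using A U by blast
  ultimately have "\<exists>W. flow_box 0 W \<and> y \<in> W \<and> W \<subseteq> U \<inter> (\<Inter>z\<in>Z. A z)"
    by (rule flow_box_neighbourhood)
  then obtain W where W: "flow_box 0 W" "y \<in> W" "W \<subseteq> U \<inter> (\<Inter>z\<in>Z. A z)" by blast
  have WU: "W \<subseteq> U" using W by blast
  have "\<exists>G\<in>\<G>. sec 0 W u ` W \<subseteq> G" if u: "u \<in> topspace S" "P 0 u \<in> W" for u
  proof -
    have uU: "P 0 u \<in> U" using u WU by blast
    \<comment> \<open>\<open>z\<close> names the sheet of \<open>u\<close>: at level
      \<open>k\<close> the plaques of \<open>u\<close> and of the representative \<open>w z\<close>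
      meet over \<open>y\<close>, so they coincide there over all of \<open>U\<close>.\<close>
    define z where "z = P k (sec 0 U u y)"
    have sy: "sec 0 U u y \<in> topspace S" by (rule sec_in [OF U(1) u(1) uU U(2)])
    have "bond q 0 k z = y"
      using bond_P [OF sy, of 0 k] P_sec [OF U(1) u(1) uU U(2)] by (simp add: z_def)
    then have z: "z \<in> Z" using P_in [OF sy] by (simp add: Z_def z_def)
    have wU: "w z \<in> topspace S" "P 0 (w z) \<in> U" using w w0 U(2) z by auto
    obtain G where G: "G \<in> \<G>" "{v \<in> topspace S. P k v \<in> B z} \<subseteq> G" using B [OF z] by blast
    have "sec 0 W u b \<in> G" if b: "b \<in> W" for b
    proof -
      have bU: "b \<in> U" using b WU by blast
      have "sec 0 U (w z) y = w z" using sec_P [OF U(1) wU] w0 [OF z] by simp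
      then have "P (0 + k) (sec 0 U u y) = P (0 + k) (sec 0 U (w z) y)" using w [OF z] by (simp add: z_def)
      then have "P (0 + k) (sec 0 U u b) = P (0 + k) (sec 0 U (w z) b)"
        by (rule sec_level [OF U(1) u(1) uU wU U(2) _ bU])
      moreover have "b \<in> A z" using b W(3) z by blast
      ultimately have "P k (sec 0 U u b) \<in> B z" by (simp add: A_def)
      then have "sec 0 U u b \<in> G" using G(2) sec_in [OF U(1) u(1) uU bU] by blast
      then show ?thesis using sec_subset [OF U(1) W(1) WU u b] by simp
    qed
    then show ?thesis using G(1) by blast
  qed
  then show ?thesis using W U by (intro exI [of _ W]) blast
qed

end

section \<open>Two families of projections on one space\<close>

lemma connected_space_locally_constant:
  assumes con: "connected_space X"
    and loc: "\<And>x. x \<in> topspace X \<Longrightarrow> \<exists>U. openin X U \<and> x \<in> U \<and> (\<forall>z\<in>U. f z = f x)"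
    and x: "x \<in> topspace X" and y: "y \<in> topspace X"
  shows "f y = f x"
proof -
  have op: "openin X {z \<in> topspace X. A (f z)}" for A
  proof (subst openin_subopen, rule ballI)
    fix z assume z: "z \<in> {z \<in> topspace X. A (f z)}"
    then obtain U where U: "openin X U" "z \<in> U" "\<forall>w\<in>U. f w = f z" using loc by blast
    have "U \<subseteq> {z \<in> topspace X. A (f z)}"
    proof
      fix w assume w: "w \<in> U"
      then have "f w = f z" using U(3) by blast
      then show "w \<in> {z \<in> topspace X. A (f z)}" using z w openin_subset [OF U(1)] by auto
    qed
    then show "\<exists>U. openin X U \<and> z \<in> U \<and> U \<subseteq> {z \<in> topspace X. A (f z)}" using U by blast
  qed
  have "{z \<in> topspace X. f z \<noteq> f x} = {}"
    using connected_spaceD [OF con op [of "\<lambda>c. c = f x"] op [of "\<lambda>c. c \<noteq> f x"]] x by blast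
  then show ?thesis using y by blast
qed

locale two_projections =
  X: solenoid_projections S M q P + Y: solenoid_projections S M' q' P'
  for S :: "'c topology" and M :: "nat \<Rightarrow> 'a topology" and q P
    and M' :: "nat \<Rightarrow> 'b topology" and q' P'
begin

text \<open>\<open>\<V>\<close> is chosen first, for the first family. Then \<open>\<U>\<close>
  collects flow boxes of the second family so small that each of their plaques lies over one member
  of \<open>\<V>\<close>, and \<open>\<W>\<close> refines \<open>\<U>\<close> for the pair
  condition.\<close>

lemma exists_refinements:
  shows "\<exists>\<V> \<W>. (\<forall>V\<in>\<V>. openin (M 0) V) \<and> topspace (M 0) \<subseteq> \<Union>\<V> \<and>
    (\<forall>V\<in>\<V>. \<forall>V'\<in>\<V>. V \<inter> V' \<noteq> {} \<longrightarrow> (\<exists>G. X.flow_box 0 G \<and> V \<union> V' \<subseteq> G)) \<and>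
    (\<forall>W\<in>\<W>. Y.flow_box 0 W) \<and> topspace (M' 0) \<subseteq> \<Union>\<W> \<and>
    (\<forall>W\<in>\<W>. \<forall>W'\<in>\<W>. W \<inter> W' \<noteq> {} \<longrightarrow> (\<exists>G. Y.flow_box 0 G \<and> W \<union> W' \<subseteq> G)) \<and>
    (\<forall>W\<in>\<W>. \<forall>u\<in>topspace S. P' 0 u \<in> W \<longrightarrow> (\<exists>V\<in>\<V>. \<forall>b\<in>W. P 0 (Y.sec 0 W u b) \<in> V))"
proof -
  have X_cover: "topspace (M 0) \<subseteq> \<Union>{G. X.flow_box 0 G}"
  proof
    fix x assume "x \<in> topspace (M 0)"
    then obtain G where "X.flow_box 0 G" "x \<in> G" using X.flow_box_neighbourhood [OF openin_topspace] by blast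
    then show "x \<in> \<Union>{G. X.flow_box 0 G}" by blast
  qed
  have X_open: "\<forall>G\<in>{G. X.flow_box 0 G}. openin (M 0) G" using X.flow_box_openin by simp
  from compact_Hausdorff_pair_refinement [OF X.manifold(1,2) X_open X_cover]
  obtain \<V> where V: "\<forall>V\<in>\<V>. openin (M 0) V" "topspace (M 0) \<subseteq> \<Union>\<V>"
    "\<forall>V\<in>\<V>. \<forall>V'\<in>\<V>. V \<inter> V' \<noteq> {} \<longrightarrow> (\<exists>G\<in>{G. X.flow_box 0 G}. V \<union> V' \<subseteq> G)"
    by (elim exE conjE)
  define \<G> where "\<G> = (\<lambda>V. {v \<in> topspace S. P 0 v \<in> V}) ` \<V>"
  have G_open: "\<forall>G\<in>\<G>. openin S G"
    unfolding \<G>_def using openin_continuous_map_preimage [OF X.continuous_P] V(1) by blast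
  have "u \<in> \<Union>\<G>" if "u \<in> topspace S" for u
    using X.P_in [OF that, of 0] V(2) that by (auto simp: \<G>_def)
  then have G_cover: "topspace S \<subseteq> \<Union>\<G>" by blast
  define \<U> where "\<U> = {W. Y.flow_box 0 W \<and>
    (\<forall>u\<in>topspace S. P' 0 u \<in> W \<longrightarrow> (\<exists>V\<in>\<V>. \<forall>b\<in>W. P 0 (Y.sec 0 W u b) \<in> V))}"
  have "\<exists>W\<in>\<U>. y \<in> W" if y: "y \<in> topspace (M' 0)" for y
  proof -
    obtain W where W: "Y.flow_box 0 W" "y \<in> W"
      "\<forall>u\<in>topspace S. P' 0 u \<in> W \<longrightarrow> (\<exists>G\<in>\<G>. Y.sec 0 W u ` W \<subseteq> G)"
      using Y.small_plaques [OF G_open G_cover openin_topspace y] by (elim exE conjE)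
    have "\<exists>V\<in>\<V>. \<forall>b\<in>W. P 0 (Y.sec 0 W u b) \<in> V" if u: "u \<in> topspace S" "P' 0 u \<in> W" for u
    proof -
      obtain G where "G \<in> \<G>" "Y.sec 0 W u ` W \<subseteq> G" using W(3) u by meson
      then show ?thesis unfolding \<G>_def by blast
    qed
    then have "W \<in> \<U>" using W(1) by (simp add: \<U>_def)
    then show ?thesis using W(2) by blast
  qed
  then have U_cover: "topspace (M' 0) \<subseteq> \<Union>\<U>" by blast
  have U_open: "\<forall>U\<in>\<U>. openin (M' 0) U" using Y.flow_box_openin by (simp add: \<U>_def)
  from compact_Hausdorff_pair_refinement [OF Y.manifold(1,2) U_open U_cover]
  obtain \<W>\<^sub>0 where W0: "\<forall>W\<in>\<W>\<^sub>0. openin (M' 0) W" "topspace (M' 0) \<subseteq> \<Union>\<W>\<^sub>0"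
    "\<forall>W\<in>\<W>\<^sub>0. \<forall>W'\<in>\<W>\<^sub>0. W \<inter> W' \<noteq> {} \<longrightarrow> (\<exists>G\<in>\<U>. W \<union> W' \<subseteq> G)"
    by (elim exE conjE)
  \<comment> \<open>The pair refinement yields merely open sets; flow boxes inside them inherit the
    pair property.\<close>
  define \<W> where "\<W> = {W. Y.flow_box 0 W \<and> (\<exists>W\<^sub>0\<in>\<W>\<^sub>0. W \<subseteq> W\<^sub>0)}"
  have "\<exists>W\<in>\<W>. y \<in> W" if "y \<in> topspace (M' 0)" for y
  proof -
    obtain W\<^sub>0 where W\<^sub>0: "W\<^sub>0 \<in> \<W>\<^sub>0" "y \<in> W\<^sub>0" using \<open>y \<in> topspace (M' 0)\<close> W0(2) by blast
    then have "openin (M' 0) W\<^sub>0" using W0(1) by blast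
    from Y.flow_box_neighbourhood [OF this W\<^sub>0(2)] show ?thesis using W\<^sub>0(1) unfolding \<W>_def by blast
  qed
  then have "topspace (M' 0) \<subseteq> \<Union>\<W>" by blast
  moreover have pair: "\<exists>G\<in>\<U>. W \<union> W' \<subseteq> G" if WW: "W \<in> \<W>" "W' \<in> \<W>" "W \<inter> W' \<noteq> {}" for W W'
  proof -
    obtain A B where AB: "A \<in> \<W>\<^sub>0" "B \<in> \<W>\<^sub>0" "W \<subseteq> A" "W' \<subseteq> B" using WW(1,2) unfolding \<W>_def by blast
    then have "A \<inter> B \<noteq> {}" using WW(3) by blast
    then obtain G where "G \<in> \<U>" "A \<union> B \<subseteq> G" using W0(3) AB(1,2) by meson
    then show ?thesis using AB(3,4) by blast
  qed
  moreover have "\<exists>V\<in>\<V>. \<forall>b\<in>W. P 0 (Y.sec 0 W u b) \<in> V"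
    if W: "W \<in> \<W>" and u: "u \<in> topspace S" "P' 0 u \<in> W" for W u
  proof -
    \<comment> \<open>Pairing \<open>W\<close> with itself puts it inside a member of
      \<open>\<U>\<close>, whose plaques are already controlled.\<close>
    have "W \<inter> W \<noteq> {}" using u(2) by blast
    then obtain G where G: "G \<in> \<U>" "W \<subseteq> G" using pair [OF W W] by blast
    have gW: "Y.flow_box 0 W" and gG: "Y.flow_box 0 G" using W G by (auto simp: \<W>_def \<U>_def)
    have "P' 0 u \<in> G" using u(2) G(2) by blast
    then obtain V where V: "V \<in> \<V>" "\<forall>b\<in>G. P 0 (Y.sec 0 G u b) \<in> V"
      using G(1) u(1) unfolding \<U>_def by blast
    have "P 0 (Y.sec 0 W u b) \<in> V" if b: "b \<in> W" for b
      using Y.sec_subset [OF gG gW G(2) u b] V(2) G(2) b by (metis subsetD)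
    then show ?thesis using V(1) by blast
  qed
  moreover have "\<forall>W\<in>\<W>. Y.flow_box 0 W" by (simp add: \<W>_def)
  moreover have "\<forall>W\<in>\<W>. \<forall>W'\<in>\<W>. W \<inter> W' \<noteq> {} \<longrightarrow> (\<exists>G. Y.flow_box 0 G \<and> W \<union> W' \<subseteq> G)"
  proof (intro ballI impI)
    fix W W' assume "W \<in> \<W>" "W' \<in> \<W>" "W \<inter> W' \<noteq> {}"
    then obtain G where "G \<in> \<U>" "W \<union> W' \<subseteq> G" using pair by meson
    then show "\<exists>G. Y.flow_box 0 G \<and> W \<union> W' \<subseteq> G" unfolding \<U>_def by blast
  qed
  moreover have "\<forall>V\<in>\<V>. \<forall>V'\<in>\<V>. V \<inter> V' \<noteq> {} \<longrightarrow> (\<exists>G. X.flow_box 0 G \<and> V \<union> V' \<subseteq> G)"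
    using V(3) by simp
  ultimately show ?thesis using V(1,2) by (intro exI [of _ \<V>] exI [of _ \<W>] conjI) simp_all
qed

end

text \<open>\<open>V_pair\<close> and \<open>W_pair\<close> allow connected sets over two
  overlapping members to be treated in one flow box. Beyond the shared space \<open>S\<close>,
  \<open>W_plaque\<close> is the only link between the two families.\<close>

locale refined_projections = two_projections S M q P M' q' P'
  for S :: "'c topology" and M :: "nat \<Rightarrow> 'a topology" and q P
    and M' :: "nat \<Rightarrow> 'b topology" and q' P' +
  fixes \<V> :: "'a set set" and \<W> :: "'b set set"
  assumes V_open: "V \<in> \<V> \<Longrightarrow> openin (M 0) V" and V_cover: "topspace (M 0) \<subseteq> \<Union>\<V>"
    and V_pair: "V \<in> \<V> \<Longrightarrow> V' \<in> \<V> \<Longrightarrow> V \<inter> V' \<noteq> {} \<Longrightarrow> \<exists>G. X.flow_box 0 G \<and> V \<union> V' \<subseteq> G"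
    and W_good: "W \<in> \<W> \<Longrightarrow> Y.flow_box 0 W" and W_cover: "topspace (M' 0) \<subseteq> \<Union>\<W>"
    and W_pair: "W \<in> \<W> \<Longrightarrow> W' \<in> \<W> \<Longrightarrow> W \<inter> W' \<noteq> {} \<Longrightarrow> \<exists>G. Y.flow_box 0 G \<and> W \<union> W' \<subseteq> G"
    and W_plaque: "W \<in> \<W> \<Longrightarrow> u \<in> topspace S \<Longrightarrow> P' 0 u \<in> W \<Longrightarrow>
      \<exists>V\<in>\<V>. \<forall>b\<in>W. P 0 (Y.sec 0 W u b) \<in> V"
begin

section \<open>Counting the sheets met by a fibre\<close>

text \<open>
  A small connected set joins \<open>u\<close> to a point with the same image as \<open>v\<close> in \<open>M' j\<close>. For points over
  a common \<open>W \<in> \<W>\<close> this is an equivalence relation, see \<open>related_iff\<close>, but its definition does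
  not refer to a choice of \<open>W\<close>; so the number of classes can be compared between distant fibres.
\<close>

definition related :: "nat \<Rightarrow> 'c \<Rightarrow> 'c \<Rightarrow> bool" where
  "related j u v \<longleftrightarrow> (\<exists>W\<in>\<W>. \<exists>C w. connectedin S C \<and> (\<forall>c\<in>C. P' 0 c \<in> W) \<and> u \<in> C \<and> w \<in> C \<and> P' j w = P' j v)"

text \<open>For \<open>K = fib k x\<close> this is the n(k,j) of the overview. The sets counted are
  known to be equivalence classes once \<open>K\<close> lies over one member of
  \<open>\<W>\<close>.\<close>

definition class_count :: "nat \<Rightarrow> 'c set \<Rightarrow> nat" where
  "class_count j K = card ((\<lambda>u. {v \<in> K. related j u v}) ` K)"

definition fib :: "nat \<Rightarrow> 'a \<Rightarrow> 'c set" where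
  "fib k x = {v \<in> topspace S. P k v = x}"

text \<open>\<open>W\<close> and \<open>W'\<close> overlap at \<open>P' 0 u\<close>, so one flow box
  contains both. Over it the plaque of \<open>u\<close> contains \<open>C\<close> and hence
  \<open>w\<close>; restriction to \<open>W\<close> keeps the two sections equal.\<close>

lemma same_plaque:
  assumes W: "W \<in> \<W>" "W' \<in> \<W>" and C: "connectedin S C" "\<And>c. c \<in> C \<Longrightarrow> P' 0 c \<in> W'"
    and u: "u \<in> C" "P' 0 u \<in> W" and w: "w \<in> C" "P' 0 w \<in> W" and y: "y \<in> W"
  shows "Y.sec 0 W u y = Y.sec 0 W w y"
proof -
  have CS: "C \<subseteq> topspace S" using C(1) by (simp add: connectedin_def)
  have uS: "u \<in> topspace S" and wS: "w \<in> topspace S" using CS u w by auto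
  have "W \<inter> W' \<noteq> {}" using u C(2) by blast
  then obtain G where G: "Y.flow_box 0 G" "W \<union> W' \<subseteq> G" using W_pair W by blast
  have WG: "W \<subseteq> G" and in_G: "P' 0 u \<in> G" "P' 0 w \<in> G" "y \<in> G" using G(2) u w y by auto
  have "Y.sec 0 G u (P' 0 w) = w"
    by (rule Y.sec_of_connectedin [OF G(1) uS in_G(1) C(1) _ u(1) w(1)]) (use C(2) G(2) in blast)
  then have "Y.sec 0 G w y = Y.sec 0 G u y"
    using Y.sec_sec [OF G(1) uS in_G(1,2,3)] by simp
  then show ?thesis
    using Y.sec_subset [OF G(1) W_good [OF W(1)] WG uS u(2) y]
      Y.sec_subset [OF G(1) W_good [OF W(1)] WG wS w(2) y] by simp
qed

text \<open>Sliding along plaques over \<open>W\<close> to the base point \<open>y\<close> turns the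
  relation into equality at level \<open>j\<close>. The connected set in the relation may lie over
  another member of \<open>\<W>\<close>; \<open>same_plaque\<close> transfers it to
  \<open>W\<close>.\<close>

lemma related_iff:
  assumes W: "W \<in> \<W>" and u: "u \<in> topspace S" "P' 0 u \<in> W" and v: "v \<in> topspace S" "P' 0 v \<in> W"
    and y: "y \<in> W"
  shows "related j u v \<longleftrightarrow> P' j (Y.sec 0 W u y) = P' j (Y.sec 0 W v y)"
proof
  assume "related j u v"
  then obtain W' C w where W': "W' \<in> \<W>" and C: "connectedin S C" "\<forall>c\<in>C. P' 0 c \<in> W'"
    and uw: "u \<in> C" "w \<in> C" "P' j w = P' j v"
    unfolding related_def by blast
  have wS: "w \<in> topspace S" using C(1) uw(2) by (auto simp: connectedin_def)
  have w0: "P' 0 w = P' 0 v" using Y.P_eq_below [OF wS v(1) uw(3)] by simp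
  then have wW: "P' 0 w \<in> W" using v by simp
  have "Y.sec 0 W u y = Y.sec 0 W w y"
    using same_plaque [OF W W' C(1) _ uw(1) u(2) uw(2) wW y] C(2) by blast
  moreover have "P' (0 + j) (Y.sec 0 W w (P' 0 w)) = P' (0 + j) (Y.sec 0 W v (P' 0 w))"
    using Y.sec_P [OF W_good [OF W] wS wW] Y.sec_P [OF W_good [OF W] v] uw(3) w0 by simp
  then have "P' (0 + j) (Y.sec 0 W w y) = P' (0 + j) (Y.sec 0 W v y)"
    by (rule Y.sec_level [OF W_good [OF W] wS wW v wW _ y])
  ultimately show "P' j (Y.sec 0 W u y) = P' j (Y.sec 0 W v y)" by simp
next
  assume eq: "P' j (Y.sec 0 W u y) = P' j (Y.sec 0 W v y)"
  \<comment> \<open>The plaque of \<open>u\<close> over \<open>W\<close> serves as the connecting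
    set, and \<open>?w\<close> is its point above \<open>P' 0 v\<close>.\<close>
  let ?w = "Y.sec 0 W u (P' 0 v)"
  have "P' (0 + j) (Y.sec 0 W u y) = P' (0 + j) (Y.sec 0 W v y)" using eq by simp
  then have "P' (0 + j) ?w = P' (0 + j) (Y.sec 0 W v (P' 0 v))"
    by (rule Y.sec_level [OF W_good [OF W] u v y _ v(2)])
  then have "P' j ?w = P' j v" using Y.sec_P [OF W_good [OF W] v] by simp
  moreover have "connectedin S (Y.sec 0 W u ` W)" by (rule Y.plaque_connectedin [OF W_good [OF W] u])
  moreover have "\<forall>c\<in>Y.sec 0 W u ` W. P' 0 c \<in> W" using Y.P_sec [OF W_good [OF W] u] by auto
  moreover have "u \<in> Y.sec 0 W u ` W" by (rule Y.plaque_mem [OF W_good [OF W] u])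
  moreover have "?w \<in> Y.sec 0 W u ` W" using v(2) by blast
  ultimately show "related j u v" unfolding related_def using W by blast
qed

text \<open>The classes are the fibres of the transport map to \<open>y\<close>, so its image counts
  them.\<close>

lemma class_count_eq:
  assumes W: "W \<in> \<W>" and K: "K \<subseteq> topspace S" "\<And>v. v \<in> K \<Longrightarrow> P' 0 v \<in> W" and y: "y \<in> W"
  shows "class_count j K = card ((\<lambda>u. P' j (Y.sec 0 W u y)) ` K)"
proof -
  let ?t = "\<lambda>u. P' j (Y.sec 0 W u y)"
  have "{v \<in> K. related j u v} = {v \<in> K. ?t v = ?t u}" if u: "u \<in> K" for u
  proof -
    have "related j u v \<longleftrightarrow> ?t v = ?t u" if "v \<in> K" for v
    proof -
      have "u \<in> topspace S" "v \<in> topspace S" using u that K(1) by auto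
      then show ?thesis
        using related_iff [OF W _ K(2) [OF u] _ K(2) [OF that] y, of j] by (metis (no_types))
    qed
    then show ?thesis by blast
  qed
  then have "(\<lambda>u. {v \<in> K. related j u v}) ` K = (\<lambda>z. {v \<in> K. ?t v = z}) ` (?t ` K)"
    by (simp add: image_image)
  moreover have "inj_on (\<lambda>z. {v \<in> K. ?t v = z}) (?t ` K)"
    by (rule inj_onI) blast
  ultimately show ?thesis unfolding class_count_def by (simp add: card_image)
qed

text \<open>The transported points lie in the finite fibre of \<open>M' j\<close> over
  \<open>y\<close>. This guards against \<open>card\<close> returning 0 on an infinite set.\<close>

lemma transport_finite:
  assumes W: "W \<in> \<W>" and K: "K \<subseteq> topspace S" "\<And>v. v \<in> K \<Longrightarrow> P' 0 v \<in> W" and y: "y \<in> W"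
  shows "finite ((\<lambda>u. P' j (Y.sec 0 W u y)) ` K)"
proof (rule finite_subset)
  have "y \<in> topspace (M' 0)" using y Y.flow_box_subset [OF W_good [OF W]] by blast
  from Y.bond_fibre_card [OF this, of j]
  show "finite {z \<in> topspace (M' (0 + j)). bond q' 0 j z = y}" by blast
  show "(\<lambda>u. P' j (Y.sec 0 W u y)) ` K \<subseteq> {z \<in> topspace (M' (0 + j)). bond q' 0 j z = y}"
  proof
    fix z assume "z \<in> (\<lambda>u. P' j (Y.sec 0 W u y)) ` K"
    then obtain u where u: "u \<in> K" "z = P' j (Y.sec 0 W u y)" by blast
    then have uS: "u \<in> topspace S" "P' 0 u \<in> W" using K by auto
    have s: "Y.sec 0 W u y \<in> topspace S" by (rule Y.sec_in [OF W_good [OF W] uS y])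
    show "z \<in> {z \<in> topspace (M' (0 + j)). bond q' 0 j z = y}"
      using Y.P_in [OF s] Y.bond_P [OF s, of 0 j] Y.P_sec [OF W_good [OF W] uS y] u(2) by simp
  qed
qed

lemma W_preimage_open: "W \<in> \<W> \<Longrightarrow> openin S {v \<in> topspace S. P' 0 v \<in> W}"
  using openin_continuous_map_preimage [OF Y.continuous_P Y.flow_box_openin [OF W_good]] by blast

lemma fib_small: "\<exists>k\<^sub>0. \<forall>k\<ge>k\<^sub>0. \<forall>x\<in>topspace (M k). \<exists>W\<in>\<W>. \<forall>v\<in>fib k x. P' 0 v \<in> W"
proof -
  let ?\<G> = "(\<lambda>W. {v \<in> topspace S. P' 0 v \<in> W}) ` \<W>"
  have "\<forall>G\<in>?\<G>. openin S G" using W_preimage_open by blast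
  moreover have "topspace S \<subseteq> \<Union>?\<G>"
  proof
    fix u assume u: "u \<in> topspace S"
    then obtain W where "W \<in> \<W>" "P' 0 u \<in> W" using Y.P_in W_cover by blast
    then show "u \<in> \<Union>?\<G>" using u by blast
  qed
  ultimately obtain k\<^sub>0 where
    k0: "\<forall>k\<ge>k\<^sub>0. \<forall>x\<in>topspace (M k). \<exists>G\<in>?\<G>. {v \<in> topspace S. P k v = x} \<subseteq> G"
    using X.fibres_small by meson
  have "\<exists>W\<in>\<W>. \<forall>v\<in>fib k x. P' 0 v \<in> W" if k: "k \<ge> k\<^sub>0" and x: "x \<in> topspace (M k)" for k x
  proof -
    obtain G where G: "G \<in> ?\<G>" "fib k x \<subseteq> G" using k0 k x unfolding fib_def by meson
    then show ?thesis by blast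
  qed
  then show ?thesis by blast
qed

lemma fib_tube:
  assumes x: "x \<in> topspace (M k)" and W: "W \<in> \<W>" "\<forall>v\<in>fib k x. P' 0 v \<in> W"
  shows "\<exists>B. X.flow_box k B \<and> x \<in> B \<and> (\<forall>v\<in>topspace S. P k v \<in> B \<longrightarrow> P' 0 v \<in> W)"
proof -
  have "{v \<in> topspace S. P k v = x} \<subseteq> {v \<in> topspace S. P' 0 v \<in> W}"
    using W(2) by (auto simp: fib_def)
  from X.tube [OF W_preimage_open [OF W(1)] x this]
  obtain N where N: "openin (M k) N" "x \<in> N" "{v \<in> topspace S. P k v \<in> N} \<subseteq> {v \<in> topspace S. P' 0 v \<in> W}"
    by blast
  obtain B where "X.flow_box k B" "x \<in> B" "B \<subseteq> N" using X.flow_box_neighbourhood [OF N(1,2)] by blast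
  then show ?thesis using N(3) by (intro exI [of _ B]) blast
qed

lemma fib_subset: "fib k x \<subseteq> topspace S"
  by (auto simp: fib_def)

text \<open>Nearby fibres are matched by sliding along plaques of the first family. Such a plaque
  over a narrow \<open>B\<close> stays over \<open>W\<close>, so by \<open>same_plaque\<close> the
  plaque of the second family does not change, and the transported sets coincide.\<close>

lemma class_count_constant:
  assumes small: "\<forall>x\<in>topspace (M k). \<exists>W\<in>\<W>. \<forall>v\<in>fib k x. P' 0 v \<in> W"
    and x: "x \<in> topspace (M k)" and x': "x' \<in> topspace (M k)"
  shows "class_count j (fib k x') = class_count j (fib k x)"
proof (rule connected_space_locally_constant [OF X.manifold(3) [of k] _ x x'])
  fix x assume x: "x \<in> topspace (M k)"
  obtain W where W: "W \<in> \<W>" "\<forall>v\<in>fib k x. P' 0 v \<in> W" using small x by blast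
  obtain u where u: "u \<in> topspace S" "P k u = x" using X.P_surj [OF x] by blast
  define y where "y = P' 0 u"
  have y: "y \<in> W" using W(2) u by (simp add: y_def fib_def)
  obtain B where B: "X.flow_box k B" "x \<in> B" "\<forall>v\<in>topspace S. P k v \<in> B \<longrightarrow> P' 0 v \<in> W"
    using fib_tube [OF x W] by blast
  let ?t = "\<lambda>u. P' j (Y.sec 0 W u y)"
  have fibW: "P' 0 v \<in> W" if "v \<in> fib k z" "z \<in> B" for v z
    using that B(3) by (auto simp: fib_def)
  have sub: "?t ` fib k z \<subseteq> ?t ` fib k z'" if z: "z \<in> B" "z' \<in> B" for z z'
  proof
    fix c assume "c \<in> ?t ` fib k z"
    then obtain v where v: "v \<in> fib k z" "c = ?t v" by blast
    then have vS: "v \<in> topspace S" "P k v \<in> B" using z by (auto simp: fib_def)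
    let ?v' = "X.sec k B v z'"
    have v': "?v' \<in> fib k z'"
      using X.sec_in [OF B(1) vS z(2)] X.P_sec [OF B(1) vS z(2)] by (simp add: fib_def)
    have over: "P' 0 b \<in> W" if "b \<in> X.sec k B v ` B" for b
      using that X.sec_in [OF B(1) vS] X.P_sec [OF B(1) vS] B(3) by auto
    have "Y.sec 0 W v y = Y.sec 0 W ?v' y"
      by (rule same_plaque [OF W(1) W(1) X.plaque_connectedin [OF B(1) vS] over])
        (use X.plaque_mem [OF B(1) vS] z y v v' fibW in auto)
    then show "c \<in> ?t ` fib k z'" using v' v(2) by auto
  qed
  have "class_count j (fib k z) = class_count j (fib k x)" if z: "z \<in> B" for z
  proof -
    have "?t ` fib k z = ?t ` fib k x" using sub [OF z B(2)] sub [OF B(2) z] by blast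
    then show ?thesis
      using class_count_eq [OF W(1) fib_subset fibW y, of k z] z
        class_count_eq [OF W(1) fib_subset fibW y, of k x] B(2) by auto
  qed
  then show "\<exists>U. openin (M k) U \<and> x \<in> U \<and> (\<forall>z\<in>U. class_count j (fib k z) = class_count j (fib k x))"
    using B(2) X.flow_box_openin [OF B(1)] by blast
qed

text \<open>
  This is where plaques of the second family must be contained in plaques of the first: the
  connected set relating \<open>u\<close> and \<open>v\<close> is small for \<open>P 0\<close> as well.
\<close>

lemma related_separates:
  "\<exists>j\<^sub>0. \<forall>j\<ge>j\<^sub>0. \<forall>u\<in>topspace S. \<forall>v\<in>topspace S. P 0 u = P 0 v \<longrightarrow> related j u v \<longrightarrow> P k u = P k v"
proof -
  \<comment> \<open>These are flow boxes at level \<open>k\<close> lying over one member of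
    \<open>\<V>\<close>. For large \<open>j\<close>, all points with a given image in
    \<open>M' j\<close> are sent by \<open>P k\<close> into one such box.\<close>
  define \<B> where "\<B> = {B. X.flow_box k B \<and> (\<exists>V\<in>\<V>. bond q 0 k ` B \<subseteq> V)}"
  let ?\<G> = "(\<lambda>B. {v \<in> topspace S. P k v \<in> B}) ` \<B>"
  have "\<forall>G\<in>?\<G>. openin S G"
    using openin_continuous_map_preimage [OF X.continuous_P X.flow_box_openin] by (auto simp: \<B>_def)
  moreover have "topspace S \<subseteq> \<Union>?\<G>"
  proof
    fix u assume u: "u \<in> topspace S"
    then obtain V where V: "V \<in> \<V>" "P 0 u \<in> V" using X.P_in V_cover by blast
    let ?N = "{z \<in> topspace (M (0 + k)). bond q 0 k z \<in> V}"
    have "openin (M (0 + k)) ?N"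
      by (rule openin_continuous_map_preimage [OF X.continuous_bond V_open [OF V(1)]])
    then have "openin (M k) ?N" by simp
    moreover have "P k u \<in> ?N" using X.bond_P [OF u, of 0 k] X.P_in [OF u, of k] V(2) by simp
    ultimately have "\<exists>B. X.flow_box k B \<and> P k u \<in> B \<and> B \<subseteq> ?N" by (rule X.flow_box_neighbourhood)
    then obtain B where B: "X.flow_box k B" "P k u \<in> B" "B \<subseteq> ?N" by blast
    then have "B \<in> \<B>" using V(1) by (auto simp: \<B>_def)
    then show "u \<in> \<Union>?\<G>" using u B(2) by blast
  qed
  ultimately obtain j\<^sub>0 where
    j0: "\<forall>j\<ge>j\<^sub>0. \<forall>y\<in>topspace (M' j). \<exists>G\<in>?\<G>. {v \<in> topspace S. P' j v = y} \<subseteq> G"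
    using Y.fibres_small by meson
  have "P k u = P k v" if j: "j \<ge> j\<^sub>0" and u: "u \<in> topspace S" and v: "v \<in> topspace S"
    and eq: "P 0 u = P 0 v" and rel: "related j u v" for j u v
  proof -
    obtain W C w where W: "W \<in> \<W>" and C: "connectedin S C" "\<forall>c\<in>C. P' 0 c \<in> W"
      and uw: "u \<in> C" "w \<in> C" "P' j w = P' j v"
      using rel unfolding related_def by blast
    have CS: "C \<subseteq> topspace S" using C(1) by (simp add: connectedin_def)
    have uW: "P' 0 u \<in> W" using C(2) uw(1) by blast
    obtain V where V: "V \<in> \<V>" "\<forall>b\<in>W. P 0 (Y.sec 0 W u b) \<in> V" using W_plaque [OF W u uW] by blast
    \<comment> \<open>\<open>C\<close> is contained in the plaque of \<open>u\<close> over
      \<open>W\<close>, which \<open>W_plaque\<close> places over \<open>V\<close>.\<close>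
    have CV: "P 0 c \<in> V" if c: "c \<in> C" for c
    proof -
      have "Y.sec 0 W u (P' 0 c) = c"
        using Y.sec_of_connectedin [OF W_good [OF W] u uW C(1) _ uw(1) c] C(2) by blast
      then show ?thesis using V(2) C(2) c by metis
    qed
    obtain G where G: "G \<in> ?\<G>" "{v' \<in> topspace S. P' j v' = P' j v} \<subseteq> G"
      using j0 j Y.P_in [OF v, of j] by meson
    then obtain B where B: "B \<in> \<B>" "G = {v \<in> topspace S. P k v \<in> B}" by blast
    have PB: "P k w \<in> B" "P k v \<in> B" using G(2) B(2) uw(2,3) v CS by auto
    obtain V' where V': "V' \<in> \<V>" "bond q 0 k ` B \<subseteq> V'" and gB: "X.flow_box k B" using B(1) by (auto simp: \<B>_def)
    have bP: "bond q 0 k (P k s) = P 0 s" if "s \<in> topspace S" for s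
      using X.bond_P [OF that, of 0 k] by simp
    have "P 0 w \<in> V'" using bP [of w] V'(2) PB(1) CS uw(2) by force
    then have "V \<inter> V' \<noteq> {}" using CV [OF uw(2)] by blast
    then obtain A where A: "X.flow_box 0 A" "V \<union> V' \<subseteq> A" using V_pair V(1) V'(1) by blast
    \<comment> \<open>The image of \<open>C\<close> and the box \<open>B\<close> are joined at
      \<open>P k w\<close>. Their union is connected, lies over the flow box \<open>A\<close>, and
      contains \<open>P k u\<close> and \<open>P k v\<close>, which have the same image at level
      0.\<close>
    show ?thesis
    proof (rule X.bond_inj_on_connectedin [OF A(1), where D = "P k ` C \<union> B"])
      show "connectedin (M k) (P k ` C \<union> B)"
        using connectedin_continuous_map_image [OF X.continuous_P C(1)] X.flow_box_connectedin [OF gB] uw(2) PB(1)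
        by (intro connectedin_Un) auto
      show "bond q 0 k z \<in> A" if "z \<in> P k ` C \<union> B" for z
      proof (cases "z \<in> B")
        case True
        then show ?thesis using V'(2) A(2) by blast
      next
        case False
        then obtain c where c: "c \<in> C" "z = P k c" using \<open>z \<in> P k ` C \<union> B\<close> by blast
        then have "c \<in> topspace S" using CS by blast
        with c show ?thesis using bP [of c] CV [of c] A(2) by auto
      qed
      show "bond q 0 k (P k u) = bond q 0 k (P k v)" using bP u v eq by simp
    qed (use uw(1) PB(2) in auto)
  qed
  then show ?thesis by blast
qed

text \<open>Points of \<open>fib k x\<close> share their image at level 0, so by \<open>sep\<close>
  related ones share their image at level \<open>k + d\<close>. Hence no class meets two of the
  fibres into which \<open>fib k x\<close> splits.\<close>

lemma class_count_additive:
  assumes x: "x \<in> topspace (M k)" and W: "W \<in> \<W>" "\<forall>v\<in>fib k x. P' 0 v \<in> W"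
    and sep: "\<forall>u\<in>topspace S. \<forall>v\<in>topspace S. P 0 u = P 0 v \<longrightarrow> related j u v \<longrightarrow> P (k + d) u = P (k + d) v"
  shows "class_count j (fib k x) =
    (\<Sum>z | z \<in> topspace (M (k + d)) \<and> bond q k d z = x. class_count j (fib (k + d) z))"
proof -
  define Z where "Z = {z \<in> topspace (M (k + d)). bond q k d z = x}"
  have finZ: "finite Z" using X.bond_fibre_card [OF x] by (simp add: Z_def)
  obtain u where u: "u \<in> topspace S" "P k u = x" using X.P_surj [OF x] by blast
  define y where "y = P' 0 u"
  have y: "y \<in> W" using W(2) u by (simp add: y_def fib_def)
  let ?t = "\<lambda>u. P' j (Y.sec 0 W u y)"
  have fib_eq: "fib k x = (\<Union>z\<in>Z. fib (k + d) z)"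
    using X.bond_P [of _ k d] X.P_in [of _ "k + d"] by (auto simp: fib_def Z_def)
  have fibW: "P' 0 v \<in> W" if "v \<in> fib (k + d) z" "z \<in> Z" for v z
    using that W(2) fib_eq by blast
  have "class_count j (fib k x) = card (?t ` fib k x)"
    using class_count_eq [OF W(1) fib_subset _ y] W(2) by blast
  also have "?t ` fib k x = (\<Union>z\<in>Z. ?t ` fib (k + d) z)" unfolding fib_eq by blast
  also have "card \<dots> = (\<Sum>z\<in>Z. card (?t ` fib (k + d) z))"
  proof (rule card_UN_disjoint [OF finZ])
    show "\<forall>z\<in>Z. finite (?t ` fib (k + d) z)"
      using transport_finite [OF W(1) fib_subset fibW y] by (intro ballI)
    show "\<forall>z\<in>Z. \<forall>z'\<in>Z. z \<noteq> z' \<longrightarrow> ?t ` fib (k + d) z \<inter> ?t ` fib (k + d) z' = {}"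
    proof (intro ballI impI equals0I)
      fix z z' c
      assume z: "z \<in> Z" "z' \<in> Z" "z \<noteq> z'" and c: "c \<in> ?t ` fib (k + d) z \<inter> ?t ` fib (k + d) z'"
      obtain a b where ab: "a \<in> fib (k + d) z" "b \<in> fib (k + d) z'" "?t a = ?t b" using c by auto
      then have aS: "a \<in> topspace S" "b \<in> topspace S" using fib_subset by auto
      have "related j a b"
        using related_iff [OF W(1) aS(1) fibW [OF ab(1) z(1)] aS(2) fibW [OF ab(2) z(2)] y, of j] ab(3) by simp
      moreover have "P k a = x" "P k b = x" using ab(1,2) z fib_eq by (auto simp: fib_def)
      then have "P 0 a = P 0 b" using X.P_eq_below [OF aS, of k 0] by simp
      ultimately have "P (k + d) a = P (k + d) b" using sep aS by blast
      then show False using ab(1,2) z(3) by (simp add: fib_def)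
    qed
  qed
  also have "\<dots> = (\<Sum>z\<in>Z. class_count j (fib (k + d) z))"
    using class_count_eq [OF W(1) fib_subset fibW y] by (intro sum.cong) auto
  finally show ?thesis by (simp add: Z_def)
qed

text \<open>
  For large \<open>j\<close> the classes of \<open>fib k x\<close> form a full preimage of their image at level \<open>j\<close>: a point
  with the same \<open>P' j\<close>-image as some point of \<open>fib k x\<close> is so close to it that sliding along a
  plaque for \<open>P k\<close> moves it into \<open>fib k x\<close>, without leaving its plaque for \<open>P' 0\<close>.
\<close>

lemma class_count_saturated:
  assumes small: "\<forall>x\<in>topspace (M k). \<exists>W\<in>\<W>. \<forall>v\<in>fib k x. P' 0 v \<in> W"
    and x: "x \<in> topspace (M k)"
  shows "\<exists>j. \<forall>d. class_count (j + d) (fib k x) * total_degree M' q' j =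
    class_count j (fib k x) * total_degree M' q' (j + d)"
proof -
  obtain W where W: "W \<in> \<W>" "\<forall>v\<in>fib k x. P' 0 v \<in> W" using small x by blast
  obtain u\<^sub>0 where u0: "u\<^sub>0 \<in> topspace S" "P k u\<^sub>0 = x" using X.P_surj [OF x] by blast
  define y where "y = P' 0 u\<^sub>0"
  have y: "y \<in> W" using W(2) u0 by (simp add: y_def fib_def)
  \<comment> \<open>These are flow boxes at level \<open>k\<close> whose whole preimage in
    \<open>S\<close> lies over one member of \<open>\<W>\<close>. The index \<open>j\<close> is then
    chosen so large that \<open>P k\<close> sends each fibre of \<open>P' j\<close> into one such
    box.\<close>
  define \<B> where "\<B> = {B. X.flow_box k B \<and> (\<exists>W\<in>\<W>. \<forall>v\<in>topspace S. P k v \<in> B \<longrightarrow> P' 0 v \<in> W)}"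
  let ?\<G> = "(\<lambda>B. {v \<in> topspace S. P k v \<in> B}) ` \<B>"
  have "\<forall>G\<in>?\<G>. openin S G"
    using openin_continuous_map_preimage [OF X.continuous_P X.flow_box_openin] by (auto simp: \<B>_def)
  moreover have "topspace S \<subseteq> \<Union>?\<G>"
  proof
    fix u assume u: "u \<in> topspace S"
    then have Pu: "P k u \<in> topspace (M k)" by (rule X.P_in)
    then obtain W' where W': "W' \<in> \<W>" "\<forall>v\<in>fib k (P k u). P' 0 v \<in> W'" using small by blast
    obtain B where B: "X.flow_box k B" "P k u \<in> B" "\<forall>v\<in>topspace S. P k v \<in> B \<longrightarrow> P' 0 v \<in> W'"
      using fib_tube [OF Pu W'] by blast
    then have "B \<in> \<B>" using W'(1) unfolding \<B>_def by blast
    then show "u \<in> \<Union>?\<G>" using u B(2) by blast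
  qed
  ultimately obtain j where
    j: "\<forall>i\<ge>j. \<forall>y\<in>topspace (M' i). \<exists>G\<in>?\<G>. {v \<in> topspace S. P' i v = y} \<subseteq> G"
    using Y.fibres_small by meson
  define t where "t i u = P' i (Y.sec 0 W u y)" for i u
  let ?K = "fib k x"
  have KW: "P' 0 u \<in> W" if "u \<in> ?K" for u using W(2) that by blast
  have count: "class_count i ?K = card (t i ` ?K)" for i
    unfolding t_def by (rule class_count_eq [OF W(1) fib_subset KW y])
  have fin: "finite (t i ` ?K)" for i
    unfolding t_def by (rule transport_finite [OF W(1) fib_subset KW y])
  note gW = W_good [OF W(1)]
  have sat: "t (j + d) ` ?K = (\<Union>z\<in>t j ` ?K. {z' \<in> topspace (M' (j + d)). bond q' j d z' = z})" (is "?L = ?R") for d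
  proof
    show "?L \<subseteq> ?R"
    proof
      fix c assume "c \<in> ?L"
      then obtain u where u: "u \<in> ?K" "c = t (j + d) u" by blast
      then have s: "Y.sec 0 W u y \<in> topspace S" using Y.sec_in [OF gW _ KW y] fib_subset by blast
      have "c \<in> topspace (M' (j + d))" "bond q' j d c = t j u"
        using Y.P_in [OF s] Y.bond_P [OF s, of j d] u(2) by (simp_all add: t_def)
      then show "c \<in> ?R" using u(1) by blast
    qed
    show "?R \<subseteq> ?L"
    proof
      fix c assume "c \<in> ?R"
      then obtain u where u: "u \<in> ?K" and c: "c \<in> topspace (M' (j + d))" "bond q' j d c = t j u" by auto
      have uS: "u \<in> topspace S" and uW: "P' 0 u \<in> W" using u fib_subset KW by auto
      have su: "Y.sec 0 W u y \<in> topspace S" by (rule Y.sec_in [OF gW uS uW y])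
      obtain v\<^sub>0 where v0: "v\<^sub>0 \<in> topspace S" "P' (j + d) v\<^sub>0 = c" using Y.P_surj [OF c(1)] by blast
      have v0j: "P' j v\<^sub>0 = t j u" using Y.bond_P [OF v0(1), of j d] v0(2) c(2) by simp
      then have v0y: "P' 0 v\<^sub>0 = y"
        using Y.P_eq_below [OF v0(1) su, of j 0] Y.P_sec [OF gW uS uW y] by (simp add: t_def)
      then have v0W: "P' 0 v\<^sub>0 \<in> W" using y by simp
      \<comment> \<open>First slide: from \<open>v\<^sub>0\<close> above \<open>y\<close>, along its
        plaque over \<open>W\<close>, to the point \<open>v\<close> above \<open>P' 0 u\<close>.
        Since \<open>v\<^sub>0\<close> and the transported \<open>u\<close> agree at level
        \<open>j\<close>, so do \<open>v\<close> and \<open>u\<close>.\<close>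
      define v where "v = Y.sec 0 W v\<^sub>0 (P' 0 u)"
      have vS: "v \<in> topspace S" unfolding v_def by (rule Y.sec_in [OF gW v0(1) v0W uW])
      have v0': "P' 0 v = P' 0 u" unfolding v_def by (rule Y.P_sec [OF gW v0(1) v0W uW])
      have "P' (0 + j) (Y.sec 0 W v\<^sub>0 y) = P' (0 + j) (Y.sec 0 W u y)"
        using Y.sec_P [OF gW v0(1) v0W] v0y v0j by (simp add: t_def)
      then have "P' (0 + j) (Y.sec 0 W v\<^sub>0 (P' 0 u)) = P' (0 + j) (Y.sec 0 W u (P' 0 u))"
        by (rule Y.sec_level [OF gW v0(1) v0W uS uW y _ uW])
      then have vj: "P' j v = P' j u" using Y.sec_P [OF gW uS uW] by (simp add: v_def)
      have "P' j u \<in> topspace (M' j)" by (rule Y.P_in [OF uS])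
      then obtain G where G: "G \<in> ?\<G>" "{v \<in> topspace S. P' j v = P' j u} \<subseteq> G"
        using j le_refl by meson
      then obtain B where B: "B \<in> \<B>" "G = {v \<in> topspace S. P k v \<in> B}" by blast
      have PB: "P k u \<in> B" "P k v \<in> B" using G(2) B(2) uS vS vj by auto
      have xB: "x \<in> B" using PB(1) u by (simp add: fib_def)
      obtain W' where gB: "X.flow_box k B" and W': "W' \<in> \<W>" "\<forall>v\<in>topspace S. P k v \<in> B \<longrightarrow> P' 0 v \<in> W'"
        using B(1) unfolding \<B>_def by blast
      \<comment> \<open>Second slide: along a plaque of the first family from \<open>v\<close> into
        \<open>fib k x\<close>. It stays over \<open>W'\<close>, so the plaque of the second family
        is unchanged and transporting \<open>v'\<close> to \<open>y\<close> returns
        \<open>v\<^sub>0\<close>.\<close>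
      define v' where "v' = X.sec k B v x"
      have v'K: "v' \<in> ?K"
        using X.sec_in [OF gB vS PB(2) xB] X.P_sec [OF gB vS PB(2) xB] by (simp add: v'_def fib_def)
      have over: "P' 0 b \<in> W'" if "b \<in> X.sec k B v ` B" for b
        using that X.sec_in [OF gB vS PB(2)] X.P_sec [OF gB vS PB(2)] W'(2) by auto
      have "Y.sec 0 W v y = Y.sec 0 W v' y"
      proof (rule same_plaque [OF W(1) W'(1) X.plaque_connectedin [OF gB vS PB(2)] over])
        show "v \<in> X.sec k B v ` B" by (rule X.plaque_mem [OF gB vS PB(2)])
        show "v' \<in> X.sec k B v ` B" using xB by (simp add: v'_def)
        show "P' 0 v \<in> W" using v0' uW by simp
        show "P' 0 v' \<in> W" by (rule KW [OF v'K])
      qed (use y in auto)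
      moreover have "Y.sec 0 W v y = v\<^sub>0"
        using Y.sec_sec [OF gW v0(1) v0W uW y] Y.sec_P [OF gW v0(1) v0W] v0y by (simp add: v_def)
      ultimately have "t (j + d) v' = c" using v0(2) by (simp add: t_def)
      then show "c \<in> ?L" using v'K by blast
    qed
  qed
  have tin: "z \<in> topspace (M' j)" if z: "z \<in> t j ` ?K" for z
  proof -
    obtain u where u: "u \<in> ?K" "z = P' j (Y.sec 0 W u y)" using z by (auto simp: t_def)
    then have "Y.sec 0 W u y \<in> topspace S" using Y.sec_in [OF gW _ KW y] fib_subset by blast
    then show ?thesis using Y.P_in u(2) by simp
  qed
  have "card (t (j + d) ` ?K) * total_degree M' q' j = card (t j ` ?K) * total_degree M' q' (j + d)" for d
  proof -
    have "card (t (j + d) ` ?K) = (\<Sum>z\<in>t j ` ?K. card {z' \<in> topspace (M' (j + d)). bond q' j d z' = z})"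
      unfolding sat using fin Y.bond_fibre_card [OF tin] by (intro card_UN_disjoint) auto
    then have "card (t (j + d) ` ?K) * total_degree M' q' j =
      (\<Sum>z\<in>t j ` ?K. card {z' \<in> topspace (M' (j + d)). bond q' j d z' = z} * total_degree M' q' j)"
      by (simp add: sum_distrib_right)
    also have "\<dots> = (\<Sum>z\<in>t j ` ?K. total_degree M' q' (j + d))"
      using Y.bond_fibre_card [OF tin] by (intro sum.cong) auto
    finally show ?thesis by simp
  qed
  then show ?thesis unfolding count by blast
qed

section \<open>Divisibility of total degrees\<close>

lemma total_degree_dvd_refined:
  "\<exists>N>0. \<forall>k. \<exists>j. total_degree M q k dvd N * total_degree M' q' j"
proof -
  obtain k\<^sub>0 where k0: "\<forall>k\<ge>k\<^sub>0. \<forall>x\<in>topspace (M k). \<exists>W\<in>\<W>. \<forall>v\<in>fib k x. P' 0 v \<in> W"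
    using fib_small by blast
  obtain x where x: "x \<in> topspace (M k\<^sub>0)" using X.manifold(4) [of k\<^sub>0] by blast
  obtain W where W: "W \<in> \<W>" "\<forall>v\<in>fib k\<^sub>0 x. P' 0 v \<in> W" using k0 x by blast
  obtain j\<^sub>0 where j0: "\<forall>d. class_count (j\<^sub>0 + d) (fib k\<^sub>0 x) * total_degree M' q' j\<^sub>0 =
    class_count j\<^sub>0 (fib k\<^sub>0 x) * total_degree M' q' (j\<^sub>0 + d)"
    using class_count_saturated [of k\<^sub>0 x] k0 x by blast
  \<comment> \<open>\<open>N\<close> involves only the fixed levels \<open>k\<^sub>0\<close> and
    \<open>j\<^sub>0\<close>; the levels compared below vary independently of it.\<close>
  define N where "N = class_count j\<^sub>0 (fib k\<^sub>0 x) * total_degree M q k\<^sub>0"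
  have "total_degree M q (k\<^sub>0 + d) dvd N * total_degree M' q' (j\<^sub>0 + j)"
    if sep: "\<forall>u\<in>topspace S. \<forall>v\<in>topspace S. P 0 u = P 0 v \<longrightarrow> related (j\<^sub>0 + j) u v \<longrightarrow> P (k\<^sub>0 + d) u = P (k\<^sub>0 + d) v"
    for d j
  proof -
    define Z where "Z = {z \<in> topspace (M (k\<^sub>0 + d)). bond q k\<^sub>0 d z = x}"
    have Z: "card Z * total_degree M q k\<^sub>0 = total_degree M q (k\<^sub>0 + d)"
      using X.bond_fibre_card [OF x] by (simp add: Z_def)
    obtain x' where x': "x' \<in> topspace (M (k\<^sub>0 + d))" using X.manifold(4) [of "k\<^sub>0 + d"] by blast
    define c where "c = class_count (j\<^sub>0 + j) (fib (k\<^sub>0 + d) x')"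
    have "class_count (j\<^sub>0 + j) (fib k\<^sub>0 x) = (\<Sum>z\<in>Z. class_count (j\<^sub>0 + j) (fib (k\<^sub>0 + d) z))"
      using class_count_additive [OF x W sep] by (simp add: Z_def)
    also have "\<dots> = (\<Sum>z\<in>Z. c)"
    proof (rule sum.cong [OF refl])
      fix z assume "z \<in> Z"
      then have z: "z \<in> topspace (M (k\<^sub>0 + d))" by (simp add: Z_def)
      have "\<forall>x\<in>topspace (M (k\<^sub>0 + d)). \<exists>W\<in>\<W>. \<forall>v\<in>fib (k\<^sub>0 + d) x. P' 0 v \<in> W"
        using spec [OF k0, of "k\<^sub>0 + d"] by simp
      from class_count_constant [OF this x' z]
      show "class_count (j\<^sub>0 + j) (fib (k\<^sub>0 + d) z) = c" by (simp add: c_def)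
    qed
    finally have "class_count (j\<^sub>0 + j) (fib k\<^sub>0 x) = card Z * c" by simp
    then have "N * total_degree M' q' (j\<^sub>0 + j) = total_degree M q (k\<^sub>0 + d) * (c * total_degree M' q' j\<^sub>0)"
      using spec [OF j0, of j] unfolding N_def Z [symmetric] by (metis mult.assoc mult.commute)
    then show ?thesis by simp
  qed
  moreover have "\<exists>j. \<forall>u\<in>topspace S. \<forall>v\<in>topspace S. P 0 u = P 0 v \<longrightarrow> related (j\<^sub>0 + j) u v \<longrightarrow>
      P (k\<^sub>0 + d) u = P (k\<^sub>0 + d) v" for d
    using related_separates [of "k\<^sub>0 + d"] by (meson le_add2)
  ultimately have dvd: "\<exists>j. total_degree M q (k\<^sub>0 + d) dvd N * total_degree M' q' j" for d
    by meson
  \<comment> \<open>Below \<open>k\<^sub>0\<close> the total degree divides that of level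
    \<open>k\<^sub>0\<close>, a factor of \<open>N\<close>, so any \<open>j\<close> will do.\<close>
  have "\<exists>j. total_degree M q k dvd N * total_degree M' q' j" for k
  proof (cases "k \<ge> k\<^sub>0")
    case True
    then show ?thesis using dvd [of "k - k\<^sub>0"] by simp
  next
    case False
    then have "total_degree M q k dvd total_degree M q k\<^sub>0"
      unfolding total_degree_def by (intro prod_dvd_prod_subset) auto
    then show ?thesis by (simp add: N_def)
  qed
  moreover have "N > 0"
  proof -
    obtain u where u: "u \<in> fib k\<^sub>0 x" using X.P_surj [OF x] by (auto simp: fib_def)
    then have y: "P' 0 u \<in> W" using W(2) by blast
    have "class_count j\<^sub>0 (fib k\<^sub>0 x) > 0"
      using class_count_eq [OF W(1) fib_subset _ y] transport_finite [OF W(1) fib_subset _ y] W(2) u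
      by (fastforce simp: card_gt_0_iff)
    then show ?thesis by (simp add: N_def X.total_degree_pos)
  qed
  ultimately show ?thesis by blast
qed

end

lemma (in two_projections) total_degree_dvd:
  "\<exists>N>0. \<forall>k. \<exists>j. total_degree M q k dvd N * total_degree M' q' j"
proof -
  obtain \<V> \<W> where "(\<forall>V\<in>\<V>. openin (M 0) V) \<and> topspace (M 0) \<subseteq> \<Union>\<V> \<and>
    (\<forall>V\<in>\<V>. \<forall>V'\<in>\<V>. V \<inter> V' \<noteq> {} \<longrightarrow> (\<exists>G. X.flow_box 0 G \<and> V \<union> V' \<subseteq> G)) \<and>
    (\<forall>W\<in>\<W>. Y.flow_box 0 W) \<and> topspace (M' 0) \<subseteq> \<Union>\<W> \<and>
    (\<forall>W\<in>\<W>. \<forall>W'\<in>\<W>. W \<inter> W' \<noteq> {} \<longrightarrow> (\<exists>G. Y.flow_box 0 G \<and> W \<union> W' \<subseteq> G)) \<and>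
    (\<forall>W\<in>\<W>. \<forall>u\<in>topspace S. P' 0 u \<in> W \<longrightarrow> (\<exists>V\<in>\<V>. \<forall>b\<in>W. P 0 (Y.sec 0 W u b) \<in> V))"
    using exists_refinements by (elim exE)
  then interpret refined_projections S M q P M' q' P' \<V> \<W>
    by unfold_locales (elim conjE; meson)+
  show ?thesis by (rule total_degree_dvd_refined)
qed

section \<open>Solenoidal manifolds and Steinitz orders\<close>

lemma topspace_solenoidal_manifold:
  "topspace (solenoidal_manifold M q) = {x. (\<forall>l. x l \<in> topspace (M l)) \<and> (\<forall>l. q (Suc l) (x (Suc l)) = x l)}"
proof -
  have "(\<forall>l\<ge>1. q l (x l) = x (l - 1)) \<longleftrightarrow> (\<forall>l. q (Suc l) (x (Suc l)) = x l)" for x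
  proof
    assume r: "\<forall>l. q (Suc l) (x (Suc l)) = x l"
    show "\<forall>l\<ge>1. q l (x l) = x (l - 1)"
    proof (intro allI impI)
      fix l :: nat assume "1 \<le> l"
      then show "q l (x l) = x (l - 1)" using r by (cases l) auto
    qed
  next
    assume r: "\<forall>l\<ge>1. q l (x l) = x (l - 1)"
    show "\<forall>l. q (Suc l) (x (Suc l)) = x l"
      using r by (metis diff_Suc_1 le_add1 plus_1_eq_Suc)
  qed
  then show ?thesis
    unfolding solenoidal_manifold_def topspace_subtopology topspace_product_topology
    by (auto simp: PiE_UNIV_domain)
qed

text \<open>Threads form a closed subset of a compact product, whence compactness. A basic open set
  restricts finitely many coordinates, and the highest of these determines the others, whence the
  basis property.\<close>

lemma solenoid_projections_solenoidal_manifold: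
  assumes "presentation M q"
  shows "solenoid_projections (solenoidal_manifold M q) M q (\<lambda>l x. x l)"
proof -
  let ?S = "solenoidal_manifold M q"
  let ?Q = "product_topology M UNIV"
  note ts = topspace_solenoidal_manifold [of M q]
  have man: "\<exists>n. \<forall>l. closed_connected_manifold n (M l)"
    and cov: "finite_covering_map (M (Suc l)) (M l) (q (Suc l))" for l
    using assms by (auto simp: presentation_def dest: spec [of _ "Suc l"])
  have comp: "compact_space (M l)" and haus: "Hausdorff_space (M l)" for l
    using man by (auto simp: closed_connected_manifold_def)
  have qc: "continuous_map (M (Suc l)) (M l) (q (Suc l))" for l
    using cov [of l] by (auto simp: finite_covering_map_def intro: covering_map_continuous)
  have S_eq: "?S = subtopology ?Q (topspace ?S)"
    unfolding solenoidal_manifold_def topspace_subtopology subtopology_restrict ..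
  have proj: "continuous_map ?Q (M l) (\<lambda>x. x l)" for l
    by (rule continuous_map_product_projection) simp
  show ?thesis
  proof
    show "\<exists>n. \<forall>l. closed_connected_manifold n (M l)" by (rule man)
    show "finite_covering_map (M (Suc l)) (M l) (q (Suc l))" for l by (rule cov)
    have "closedin ?Q {x \<in> topspace ?Q. (q (Suc l) \<circ> (\<lambda>x. x (Suc l))) x = x l}" for l
      by (rule closedin_continuous_maps_eq [OF haus continuous_map_compose [OF proj qc] proj])
    then have "closedin ?Q (\<Inter>l. {x \<in> topspace ?Q. q (Suc l) (x (Suc l)) = x l})"
      by (intro closedin_Inter) auto
    moreover have "(\<Inter>l. {x \<in> topspace ?Q. q (Suc l) (x (Suc l)) = x l}) = topspace ?S"
      unfolding ts by (auto simp: PiE_UNIV_domain)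
    ultimately have "closedin ?Q (topspace ?S)" by simp
    moreover have "compact_space ?Q" using comp by (simp add: compact_space_product_topology)
    ultimately have "compactin ?Q (topspace ?S)" by (simp add: closedin_compact_space)
    then show "compact_space ?S" using S_eq compact_space_subtopology by metis
    show "continuous_map ?S (M l) (\<lambda>x. x l)" for l
      unfolding solenoidal_manifold_def by (rule continuous_map_from_subtopology [OF proj])
    show "q (Suc l) (u (Suc l)) = u l" if "u \<in> topspace ?S" for l u
      using that unfolding ts by simp
    show "u = v" if "\<And>l. u l = v l" for u v :: "nat \<Rightarrow> 'a"
      using that by (rule ext)
    show "\<exists>k B. openin (M k) B \<and> u k \<in> B \<and> {v \<in> topspace ?S. v k \<in> B} \<subseteq> G"
      if G: "openin ?S G" "u \<in> G" for G u
    proof -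
      obtain G' where G': "openin ?Q G'" "G = G' \<inter> topspace ?S"
        using G(1) S_eq by (metis openin_subtopology)
      from product_topology_open_contains_basis [OF G'(1), of u] G(2) G'(2)
      obtain X where X: "u \<in> PiE UNIV X" "\<And>i. openin (M i) (X i)"
        "finite {i. X i \<noteq> topspace (M i)}" "PiE UNIV X \<subseteq> G'"
        by auto
      define F where "F = {i. X i \<noteq> topspace (M i)}"
      have F: "finite F" using X(3) by (simp add: F_def)
      define k where "k = Max (insert 0 F)"
      have k: "i \<le> k" if "i \<in> F" for i using F that by (simp add: k_def)
      define B where "B = topspace (M k) \<inter> (\<Inter>i\<in>F. {z \<in> topspace (M k). bond q i (k - i) z \<in> X i})"
      have "openin (M k) {z \<in> topspace (M k). bond q i (k - i) z \<in> X i}" if "i \<in> F" for i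
        using openin_continuous_map_preimage [OF continuous_map_bond [of M q, OF qc, of i "k - i"] X(2)] k [OF that]
        by simp
      then have "openin (M k) B" unfolding B_def using F by (intro openin_Int_Inter) auto
      moreover have S: "v k \<in> B \<longleftrightarrow> (\<forall>i\<in>F. v i \<in> X i)" if v: "v \<in> topspace ?S" for v
      proof -
        have "bond q i (k - i) (v k) = v i" if "i \<in> F" for i
          using bond_thread [of q v i "k - i"] v k [OF that] unfolding ts by simp
        moreover have "v k \<in> topspace (M k)" using v unfolding ts by simp
        ultimately show ?thesis by (simp add: B_def)
      qed
      moreover have uS: "u \<in> topspace ?S" using G(2) G'(2) by blast
      moreover have "u i \<in> X i" for i using X(1) by (auto simp: PiE_UNIV_domain)
      ultimately have "u k \<in> B" by blast
      moreover have "v \<in> G" if v: "v \<in> topspace ?S" "v k \<in> B" for v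
      proof -
        have "v i \<in> X i" for i
          using S [OF v(1)] v unfolding ts F_def by (cases "X i = topspace (M i)") auto
        then show ?thesis using X(4) G'(2) v(1) by (auto simp: PiE_UNIV_domain)
      qed
      ultimately show ?thesis using \<open>openin (M k) B\<close> by (intro exI [of _ k] exI [of _ B]) blast
    qed
    show "\<exists>F. continuous_map T ?S F \<and> (\<forall>l. \<forall>t\<in>topspace T. F t l = f l t)"
      if f: "\<And>l. continuous_map T (M l) (f l)"
        and fq: "\<And>l t. t \<in> topspace T \<Longrightarrow> q (Suc l) (f (Suc l) t) = f l t"
      for T :: "'a topology" and f
    proof -
      have "continuous_map T ?Q (\<lambda>t l. f l t)"
        unfolding continuous_map_componentwise_UNIV using f by blast
      moreover have "(\<lambda>l. f l t) \<in> topspace ?S" if "t \<in> topspace T" for t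
        unfolding ts using fq [OF that] f that by (auto simp: continuous_map_def)
      ultimately have "continuous_map T ?S (\<lambda>t l. f l t)"
        by (subst S_eq) (auto intro!: continuous_map_into_subtopology)
      then show ?thesis by (intro exI [of _ "\<lambda>t l. f l t"]) simp
    qed
  qed
qed

text \<open>Pulling the projections back along \<open>h\<close> is what puts both families on one
  space.\<close>

lemma solenoid_projections_homeomorphic:
  assumes "solenoid_projections S' M q P" and hom: "homeomorphic_maps S S' h g"
  shows "solenoid_projections S M q (\<lambda>l u. P l (h u))"
proof -
  interpret solenoid_projections S' M q P by fact
  have h: "continuous_map S S' h" and g: "continuous_map S' S g"
    and gh: "\<And>u. u \<in> topspace S \<Longrightarrow> g (h u) = u" and hg: "\<And>v. v \<in> topspace S' \<Longrightarrow> h (g v) = v"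
    using hom by (auto simp: homeomorphic_maps_def)
  have hS: "h u \<in> topspace S'" if "u \<in> topspace S" for u
    using h that by (auto simp: continuous_map_def)
  show ?thesis
  proof
    show "\<exists>n. \<forall>l. closed_connected_manifold n (M l)" by (rule manifolds)
    show "finite_covering_map (M (Suc l)) (M l) (q (Suc l))" for l by (rule coverings)
    have "S homeomorphic_space S'" using hom by (auto simp: homeomorphic_space_def)
    then show "compact_space S" using compact_S homeomorphic_compact_space by blast
    show "continuous_map S (M l) (\<lambda>u. P l (h u))" for l
      using continuous_map_compose [OF h continuous_P] by (simp add: o_def)
    show "q (Suc l) (P (Suc l) (h u)) = P l (h u)" if "u \<in> topspace S" for l u
      by (rule P_Suc [OF hS [OF that]])
    show "u = v" if "u \<in> topspace S" "v \<in> topspace S" "\<And>l. P l (h u) = P l (h v)" for u v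
      using separating [OF hS [OF that(1)] hS [OF that(2)] that(3)] gh that(1,2) by metis
    show "\<exists>k B. openin (M k) B \<and> P k (h u) \<in> B \<and> {v \<in> topspace S. P k (h v) \<in> B} \<subseteq> G"
      if G: "openin S G" "u \<in> G" for G u
    proof -
      have u: "u \<in> topspace S" using G openin_subset by blast
      have "openin S' {v \<in> topspace S'. g v \<in> G}" by (rule openin_continuous_map_preimage [OF g G(1)])
      moreover have "h u \<in> {v \<in> topspace S'. g v \<in> G}" using hS [OF u] gh [OF u] G(2) by simp
      ultimately obtain k B where B: "openin (M k) B" "P k (h u) \<in> B"
        "{v \<in> topspace S'. P k v \<in> B} \<subseteq> {v \<in> topspace S'. g v \<in> G}"
        using basis by meson
      have "v \<in> G" if "v \<in> topspace S" "P k (h v) \<in> B" for v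
        using B(3) hS [OF that(1)] gh [OF that(1)] that(2) by auto
      then show ?thesis using B(1,2) by (intro exI [of _ k] exI [of _ B]) blast
    qed
    show "\<exists>F. continuous_map T S F \<and> (\<forall>l. \<forall>t\<in>topspace T. P l (h (F t)) = f l t)"
      if f: "\<And>l. continuous_map T (M l) (f l)"
        and fq: "\<And>l t. t \<in> topspace T \<Longrightarrow> q (Suc l) (f (Suc l) t) = f l t"
      for T :: "'b topology" and f
    proof -
      obtain F where F: "continuous_map T S' F" "\<forall>l. \<forall>t\<in>topspace T. P l (F t) = f l t"
        using map_into [OF f fq] by blast
      have "h (g (F t)) = F t" if "t \<in> topspace T" for t
        using hg F(1) that by (auto simp: continuous_map_def)
      then show ?thesis
        using continuous_map_compose [OF F(1) g] F(2) by (intro exI [of _ "g \<circ> F"]) simp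
    qed
  qed
qed

section \<open>Comparison of Steinitz exponents\<close>

lemma steinitz_exponent_order:
  assumes "prime p"
  shows "steinitz_exponent (steinitz_order M q) p = (SUP l\<in>{0<..}. enat (multiplicity p (total_degree M q l)))"
proof -
  have "steinitz_order M q = steinitz_LCM ((\<lambda>l. steinitz_of_nat (total_degree M q l)) ` {0<..})"
    unfolding steinitz_order_def total_degree_def by (rule arg_cong [where f = steinitz_LCM]) auto
  then show ?thesis
    using assms by (simp add: steinitz_LCM.rep_eq steinitz_of_nat.rep_eq image_image)
qed

lemma steinitz_exponent_order_le:
  assumes p: "prime p" and N: "N > 0" and pos: "\<And>j. total_degree M' q' j > 0"
    and dvd: "\<And>k. \<exists>j. total_degree M q k dvd N * total_degree M' q' j"
  shows "steinitz_exponent (steinitz_order M q) p \<le>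
    enat (multiplicity p N) + steinitz_exponent (steinitz_order M' q') p"
  unfolding steinitz_exponent_order [OF p]
proof (rule SUP_least)
  fix k :: nat
  obtain j where j: "total_degree M q k dvd N * total_degree M' q' j" using dvd by blast
  \<comment> \<open>The supremum runs over positive levels only and \<open>j\<close> may be 0, hence
    the passage to \<open>Suc j\<close>.\<close>
  have "total_degree M' q' j dvd total_degree M' q' (Suc j)" by (simp add: total_degree_def)
  then have "total_degree M q k dvd N * total_degree M' q' (Suc j)"
    using j dvd_trans mult_dvd_mono [OF dvd_refl] by blast
  then have "multiplicity p (total_degree M q k) \<le> multiplicity p (N * total_degree M' q' (Suc j))"
    using N pos by (intro dvd_imp_multiplicity_le) auto
  also have "\<dots> = multiplicity p N + multiplicity p (total_degree M' q' (Suc j))"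
    using p N pos [of "Suc j"] by (simp add: prime_elem_multiplicity_mult_distrib)
  finally have "enat (multiplicity p (total_degree M q k)) \<le>
      enat (multiplicity p N) + enat (multiplicity p (total_degree M' q' (Suc j)))" by simp
  also have "\<dots> \<le> enat (multiplicity p N) + (SUP l\<in>{0<..}. enat (multiplicity p (total_degree M' q' l)))"
    by (intro add_left_mono SUP_upper) simp
  finally show "enat (multiplicity p (total_degree M q k)) \<le> \<dots>" .
qed

text \<open>The two bounds force infinite exponents at the same primes and equal exponents at primes
  dividing neither \<open>N\<close> nor \<open>N'\<close>. What remains is a finite set of primes
  with finite exponents.\<close>

lemma steinitz_asymp_equivI:
  assumes N: "N > 0" "N' > 0"
    and le: "\<And>p. prime p \<Longrightarrow> steinitz_exponent a p \<le> enat (multiplicity p N) + steinitz_exponent b p"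
    and le': "\<And>p. prime p \<Longrightarrow> steinitz_exponent b p \<le> enat (multiplicity p N') + steinitz_exponent a p"
  shows "steinitz_asymp_equiv a b"
proof -
  \<comment> \<open>At the finitely many primes where finite exponents may differ, multiply \<open>a\<close> by the
    prime power in \<open>b\<close> and vice versa.\<close>
  define F where "F = {p \<in> prime_factors (N * N'). steinitz_exponent a p \<noteq> \<infinity>}"
  define prod_over where "prod_over c = (\<Prod>p\<in>F. p ^ the_enat (steinitz_exponent c p))" for c
  have F: "finite F" "\<And>p. p \<in> F \<Longrightarrow> prime p" by (auto simp: F_def)
  have mult: "multiplicity p (prod_over c) = (if p \<in> F then the_enat (steinitz_exponent c p) else 0)"
    if "prime p" for p c
    unfolding prod_over_def using F that by (intro multiplicity_prod_prime_powers) auto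
  have pos: "1 \<le> prod_over c" for c
    unfolding prod_over_def using F(2) by (simp add: Suc_le_eq prod_pos prime_gt_0_nat)
  have "enat (multiplicity p (prod_over b)) + steinitz_exponent a p =
      enat (multiplicity p (prod_over a)) + steinitz_exponent b p" if p: "prime p" for p
  proof (cases "steinitz_exponent a p = \<infinity>")
    case True
    then show ?thesis using le [OF p] by (cases "steinitz_exponent b p") auto
  next
    case False
    then obtain m where m: "steinitz_exponent a p = enat m" by auto
    then obtain n where n: "steinitz_exponent b p = enat n"
      using le' [OF p] by (cases "steinitz_exponent b p") auto
    show ?thesis
    proof (cases "p \<in> F")
      case True
      then show ?thesis using mult [OF p] m n by simp
    next
      case False
      then have "\<not> p dvd N * N'" using p m N by (auto simp: F_def in_prime_factors_iff)
      then have "multiplicity p N = 0" "multiplicity p N' = 0"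
        by (auto intro!: not_dvd_imp_multiplicity_0)
      then show ?thesis using le [OF p] le' [OF p] mult [OF p] False m n by simp
    qed
  qed
  moreover have "steinitz_exponent c p = 0" if "\<not> prime p" for c p
    using steinitz_exponent [of c] that by simp
  ultimately have "steinitz_of_nat (prod_over b) * a = steinitz_of_nat (prod_over a) * b"
    by (intro steinitz_exponent_inject [THEN iffD1] ext)
      (simp add: times_steinitz.rep_eq steinitz_of_nat.rep_eq)
  then show ?thesis unfolding steinitz_asymp_equiv_def using pos by blast
qed

theorem theorem1p4:
  fixes M :: "nat \<Rightarrow> 'a topology" and q :: "nat \<Rightarrow> 'a \<Rightarrow> 'a"
    and M' :: "nat \<Rightarrow> 'b topology" and q' :: "nat \<Rightarrow> 'b \<Rightarrow> 'b"
  assumes "presentation M q"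
    and "presentation M' q'"
    and "solenoidal_manifold M q homeomorphic_space solenoidal_manifold M' q'"
  shows "asymp_steinitz_order M q = asymp_steinitz_order M' q'"
proof -
  let ?S = "solenoidal_manifold M q"
  obtain h g where hom: "homeomorphic_maps ?S (solenoidal_manifold M' q') h g"
    using assms(3) by (auto simp: homeomorphic_space_def)
  interpret X: solenoid_projections ?S M q "\<lambda>l x. x l"
    by (rule solenoid_projections_solenoidal_manifold [OF assms(1)])
  interpret Y: solenoid_projections ?S M' q' "\<lambda>l u. h u l"
    by (rule solenoid_projections_homeomorphic
        [OF solenoid_projections_solenoidal_manifold [OF assms(2)] hom])
  \<comment> \<open>The divisibility statement is one-sided; exchanging the two families gives the
    other half.\<close>
  interpret XY: two_projections ?S M q "\<lambda>l x. x l" M' q' "\<lambda>l u. h u l" by unfold_locales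
  interpret YX: two_projections ?S M' q' "\<lambda>l u. h u l" M q "\<lambda>l x. x l" by unfold_locales
  obtain N where N: "N > 0" "\<And>k. \<exists>j. total_degree M q k dvd N * total_degree M' q' j"
    using XY.total_degree_dvd by blast
  obtain N' where N': "N' > 0" "\<And>k. \<exists>j. total_degree M' q' k dvd N' * total_degree M q j"
    using YX.total_degree_dvd by blast
  have "steinitz_asymp_equiv (steinitz_order M q) (steinitz_order M' q')"
    by (rule steinitz_asymp_equivI [OF N(1) N'(1)])
      (use steinitz_exponent_order_le N N' X.total_degree_pos Y.total_degree_pos in blast)+
  then have "steinitz_asymp_equiv (steinitz_order M q) = steinitz_asymp_equiv (steinitz_order M' q')"
    using equivp_steinitz_asymp_equiv by (simp add: equivp_def)
  then show ?thesis by (simp add: asymp_steinitz_order_def steinitz_asymp_class_def)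
qed

end
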